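(* Let $\xi_1=(1,1,1)$, $\xi_2=(1,-1,-1)$, $\xi_3=(-1,1,-1)$, $\xi_4=(-1,-1,1)$. The zonotope $$Z_T=\sum_{i=1}^{4}\left[-\frac{\xi_i}{16},\frac{\xi_i}{16}\right]$$ has the fourteen vertices $$\left(\pm\tfrac14,0,0\right),\quad\left(0,\pm\tfrac14,0\right),\quad\left(0,0,\pm\tfrac14\right),\quad\text{and}\quad\left(\pm\tfrac18,\pm\tfrac18,\pm\tfrac18\right),$$ where the sign choices in the last family are independent. Its edge length is $\sqrt3/8$. Hence $$R=\frac{8}{\sqrt3}Z_T$$ is a unit-edge rhombic dodecahedron. Moreover, $$w_R(u)=\frac{8}{\sqrt3}\,b_T(u)\qquad(u\in S^2),$$ where $T$ is the unit-edge regular tetrahedron $T=\operatorname{conv}\{\xi_1/\sqrt8,\xi_2/\sqrt8,\xi_3/\sqrt8,\xi_4/\sqrt8\}$.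
   Context: Here $[-a,a]$ denotes the segment with endpoints $-a,a$, and sums of segments are Minkowski sums. For a compact convex body $K\subset\mathbb{R}^3$ and $u\in S^2$, $w_K(u)=\max_{x\in K}u\cdot x-\min_{x\in K}u\cdot x$ is the width and $b_K(u)$ is the area of the orthogonal projection of $K$ onto $u^{\perp}$ (brightness). *)

theory Defs
  imports "HOL-Analysis.Analysis"
begin

subsection \<open>Width and brightness\<close>

text \<open>On a nonempty compact set both the supremum and the infimum are attained.\<close>

definition width :: "(real^3) set \<Rightarrow> real^3 \<Rightarrow> real" where
  "width K u = (SUP x\<in>K. u \<bullet> x) - (INF x\<in>K. u \<bullet> x)"

definition orth_compl :: "real^3 \<Rightarrow> (real^3) set" where
  "orth_compl u = {x. u \<bullet> x = 0}"

definition proj_along :: "real^3 \<Rightarrow> real^3 \<Rightarrow> real^3" where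
  "proj_along u x = x - ((u \<bullet> x) / (u \<bullet> u)) *\<^sub>R u"

definition plane_isometry :: "real^3 \<Rightarrow> (real^2 \<Rightarrow> real^3) \<Rightarrow> bool" where
  "plane_isometry u f \<longleftrightarrow>
     linear f \<and> (\<forall>y. norm (f y) = norm y) \<and> range f = orth_compl u"

text \<open>
  The area of a subset of the plane orthogonal to \<open>u\<close> (for nonzero \<open>u\<close>) is its two-dimensional
  Lebesgue measure in orthonormal coordinates on that plane. Such coordinates exist and the area
  does not depend on which ones are chosen: see \<open>plane_isometry_exists\<close> and
  \<open>plane_area_eq\<close> below.
\<close>

definition plane_area :: "real^3 \<Rightarrow> (real^3) set \<Rightarrow> real" where
  "plane_area u P = measure lebesgue ((SOME f. plane_isometry u f) -` P)"

definition brightness :: "(real^3) set \<Rightarrow> real^3 \<Rightarrow> real" where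
  "brightness K u = plane_area u (proj_along u ` K)"

lemma plane_isometry_exists:
  assumes "u \<noteq> 0"
  shows "\<exists>f. plane_isometry u f"
proof -
  have "dim (orth_compl u) = 2"
    using dim_hyperplane[OF assms] by (simp add: orth_compl_def)
  moreover have "subspace (orth_compl u)"
    unfolding orth_compl_def by (rule subspace_hyperplane)
  ultimately obtain f :: "real^2 \<Rightarrow> real^3"
    where "linear f" "f ` UNIV = orth_compl u" "\<And>x. norm (f x) = norm x"
    using isometry_subspaces[of "UNIV :: (real^2) set" "orth_compl u"]
    by (auto simp: dim_UNIV)
  then show ?thesis
    unfolding plane_isometry_def by blast
qed

lemma plane_isometry_measure_eq:
  assumes f: "plane_isometry u f" and g: "plane_isometry u g"
    and meas: "g -` P \<in> lmeasurable"
  shows "measure lebesgue (f -` P) = measure lebesgue (g -` P)"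
proof -
  have lf: "linear f" and nf: "\<And>y. norm (f y) = norm y" and rf: "range f = orth_compl u"
    and lg: "linear g" and ng: "\<And>y. norm (g y) = norm y" and rg: "range g = orth_compl u"
    using f g unfolding plane_isometry_def by auto
  have injf: "inj f"
    using lf nf by (metis linear_injective_0 norm_eq_zero)
  define h where "h = inv f \<circ> g"
  have fh: "f (h y) = g y" for y
    unfolding h_def using rf rg by (metis comp_apply f_inv_into_f rangeI)
  have "linear h"
  proof (rule linearI)
    show "h (x + y) = h x + h y" for x y
      by (rule injD[OF injf]) (simp add: fh linear_add[OF lf] linear_add[OF lg])
    show "h (c *\<^sub>R x) = c *\<^sub>R h x" for c x
      by (rule injD[OF injf]) (simp add: fh linear_scale[OF lf] linear_scale[OF lg])
  qed
  moreover have "norm (h y) = norm y" for y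
    by (metis fh nf ng)
  ultimately have h: "orthogonal_transformation h"
    by (simp add: orthogonal_transformation)
  have "h ` (g -` P) = f -` P"
  proof
    show "h ` (g -` P) \<subseteq> f -` P"
      using fh by auto
    show "f -` P \<subseteq> h ` (g -` P)"
    proof
      fix y assume y: "y \<in> f -` P"
      obtain z where "h z = y"
        using orthogonal_transformation_surj[OF h] by (metis surjD)
      with y show "y \<in> h ` (g -` P)"
        using fh[of z] by auto
    qed
  qed
  then show ?thesis
    using measure_orthogonal_image[OF h meas] by simp
qed

lemma plane_area_eq:
  assumes "plane_isometry u f" "f -` P \<in> lmeasurable"
  shows "plane_area u P = measure lebesgue (f -` P)"
  unfolding plane_area_def
  using assms plane_isometry_measure_eq someI[of "plane_isometry u"] by blast

subsection \<open>Polytopes\<close>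

definition has_edge_length :: "(real^3) set \<Rightarrow> real \<Rightarrow> bool" where
  "has_edge_length K l \<longleftrightarrow>
     (\<exists>e. e edge_of K) \<and>
     (\<forall>e. e edge_of K \<longrightarrow> (\<exists>a b. e = closed_segment a b \<and> dist a b = l))"

definition regular_tetrahedron :: "(real^3) set \<Rightarrow> real \<Rightarrow> bool" where
  "regular_tetrahedron K l \<longleftrightarrow> 3 simplex K \<and> has_edge_length K l"

definition rhombus :: "(real^3) set \<Rightarrow> real \<Rightarrow> real \<Rightarrow> bool" where
  "rhombus F p q \<longleftrightarrow>
     (\<exists>a v w. \<not> collinear {0, v, w} \<and> norm v = norm w \<and>
        F = convex hull {a, a + v, a + v + w, a + w} \<and>
        p = norm (v + w) \<and> q = norm (v - w))"

text \<open>
  The arguments \<open>p\<close> and \<open>q\<close> of \<^const>\<open>rhombus\<close> are the lengths of the diagonals; they determine the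
  rhombus up to congruence. Twelve congruent rhombic facets alone would also allow Bilinski's
  dodecahedron, whose facets have diagonals in the golden ratio; the ratio \<open>sqrt 2\<close> singles out the
  rhombic dodecahedron in the usual sense, the dual of the cuboctahedron.
\<close>

definition rhombic_dodecahedron :: "(real^3) set \<Rightarrow> bool" where
  "rhombic_dodecahedron K \<longleftrightarrow>
     polytope K \<and> aff_dim K = 3 \<and> card {F. F facet_of K} = 12 \<and>
     (\<exists>q>0. \<forall>F. F facet_of K \<longrightarrow> rhombus F (sqrt 2 * q) q)"

subsection \<open>The specific bodies\<close>

definition xi :: "nat \<Rightarrow> real^3" where
  "xi i = (if i = 1 then vector [1, 1, 1]
           else if i = 2 then vector [1, -1, -1]
           else if i = 3 then vector [-1, 1, -1]
           else vector [-1, -1, 1])"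

text \<open>The sum is the Minkowski sum of sets.\<close>

definition Z_T :: "(real^3) set" where
  "Z_T = (\<Sum>i\<in>{1..4}. closed_segment (- ((1/16) *\<^sub>R xi i)) ((1/16) *\<^sub>R xi i))"

definition R_body :: "(real^3) set" where
  "R_body = (\<lambda>x. (8 / sqrt 3) *\<^sub>R x) ` Z_T"

definition T_body :: "(real^3) set" where
  "T_body = convex hull ((\<lambda>i. (1 / sqrt 8) *\<^sub>R xi i) ` {1..4})"

definition Z_T_vertices :: "(real^3) set" where
  "Z_T_vertices =
     {vector [s/4, 0, 0] | s. s \<in> {-1, 1}} \<union>
     {vector [0, s/4, 0] | s. s \<in> {-1, 1}} \<union>
     {vector [0, 0, s/4] | s. s \<in> {-1, 1}} \<union>
     {vector [s/8, t/8, r/8] | s t r. s \<in> {-1, 1} \<and> t \<in> {-1, 1} \<and> r \<in> {-1, 1}}"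

end

theory Submission
  imports Defs
begin

text \<open>
  All bodies are governed by the Gram matrix of the four vectors \<open>xi i\<close> (entries 3 and -1), which
  sum to zero and form a tight frame. A combination of them with coefficients in \<open>[-r, r]\<close> is
  characterised by the twelve inequalities \<open>(xi i - xi j) \<bullet> x \<le> 8 * r\<close>, one for each facet of the
  zonotope. Faces of a Minkowski sum are sums of faces, so an edge of the zonotope is a translate
  of one of the four summands. Finally, both the width of the zonotope and the brightness of the
  tetrahedron are multiples of \<open>\<Sum>i. \<bar>u \<bullet> xi i\<bar>\<close>: the projected tetrahedron is covered twice
  by the projections of its facets, and \<open>\<bar>u \<bullet> xi i\<bar>\<close> is proportional to the projected area of the
  facet with normal \<open>xi i\<close>.
\<close>

subsection \<open>The area of the convex hull of four points in the plane\<close>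

text \<open>The constant \<open>1/16\<close> makes the width of \<open>Z_T\<close> equal to the
  brightness of \<open>T_body\<close>. A facet of the unit-edge tetrahedron has area sqrt 3 / 4 and
  unit normal \<open>xi i\<close> / sqrt 3 up to sign, so half the sum of the projected facet areas
  is 1/8 of the sum of the |u . \<open>xi i\<close>|. A segment from -v to v has width 2 |u . v|,
  and v = \<open>xi i\<close> / 16 yields the same sum. The factor 8 / sqrt 3 then only brings the
  edges to length 1. Two obstacles shape the argument. Directions parallel to a facet or an edge
  give degenerate projections, so the area formula for four points uses weak sign conditions on a
  nonzero affine dependency instead of general position. And no face lattice of the zonotope is
  given in advance, so each kind of face gets its own access: facets through an irredundant system
  of half-spaces, edges through the summands, vertices through the sixteen signed sums.\<close>

lemma convex_hull_4:
  "convex hull {a, b, c, d} =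
     {t *\<^sub>R a + u *\<^sub>R b + v *\<^sub>R c + w *\<^sub>R d | t u v w.
        0 \<le> t \<and> 0 \<le> u \<and> 0 \<le> v \<and> 0 \<le> w \<and> t + u + v + w = 1}"
  (is "_ = ?R")
proof (intro equalityI subsetI)
  fix x assume "x \<in> convex hull {a, b, c, d}"
  then obtain p q y where pq: "0 \<le> p" "0 \<le> q" "p + q = 1"
    and y: "y \<in> convex hull {b, c, d}" and x: "x = p *\<^sub>R a + q *\<^sub>R y"
    by (auto simp: convex_hull_insert[of "{b, c, d}"])
  from y obtain u v w where uvw: "0 \<le> u" "0 \<le> v" "0 \<le> w" "u + v + w = 1"
    and y: "y = u *\<^sub>R b + v *\<^sub>R c + w *\<^sub>R d"
    by (auto simp: convex_hull_3)
  have "q * u + q * v + q * w = q"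
    using uvw(4) by (metis distrib_left mult.right_neutral)
  moreover have "x = p *\<^sub>R a + (q * u) *\<^sub>R b + (q * v) *\<^sub>R c + (q * w) *\<^sub>R d"
    unfolding x y by (simp add: algebra_simps)
  ultimately show "x \<in> ?R"
    using pq uvw
    by (intro CollectI exI[of _ p] exI[of _ "q * u"] exI[of _ "q * v"] exI[of _ "q * w"]) auto
next
  fix x assume "x \<in> ?R"
  then obtain t u v w where *: "0 \<le> t" "0 \<le> u" "0 \<le> v" "0 \<le> w" "t + u + v + w = 1"
    and x: "x = t *\<^sub>R a + u *\<^sub>R b + v *\<^sub>R c + w *\<^sub>R d"
    by auto
  have "(\<Sum>i<4::nat. [t, u, v, w] ! i *\<^sub>R [a, b, c, d] ! i) \<in> convex hull {a, b, c, d}"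
  proof (rule convex_sum)
    show "(\<Sum>i<4::nat. [t, u, v, w] ! i) = 1"
      using * by (simp add: eval_nat_numeral)
    show "0 \<le> [t, u, v, w] ! i" "[a, b, c, d] ! i \<in> convex hull {a, b, c, d}" if "i \<in> {..<4}" for i
      using that * by (auto simp: eval_nat_numeral less_Suc_eq intro: hull_inc)
  qed auto
  then show "x \<in> convex hull {a, b, c, d}"
    by (simp add: x eval_nat_numeral add.assoc)
qed

text \<open>Solving the dependency for \<open>a\<close> gives a convex combination of the other
  points. The sign conditions are put on quotients because a dependency may be negated, so one
  statement serves both signs of \<alpha>.\<close>

lemma hull_eq_triangle:
  fixes a b c d :: "'a::real_vector"
  assumes "\<alpha> \<noteq> 0" "\<beta> / \<alpha> \<le> 0" "\<gamma> / \<alpha> \<le> 0" "\<delta> / \<alpha> \<le> 0"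
    and sum: "\<alpha> + \<beta> + \<gamma> + \<delta> = 0"
    and dep: "\<alpha> *\<^sub>R a + \<beta> *\<^sub>R b + \<gamma> *\<^sub>R c + \<delta> *\<^sub>R d = 0"
  shows "convex hull {a, b, c, d} = convex hull {b, c, d}"
proof -
  have "a = (1 / \<alpha>) *\<^sub>R (\<alpha> *\<^sub>R a - (\<alpha> *\<^sub>R a + \<beta> *\<^sub>R b + \<gamma> *\<^sub>R c + \<delta> *\<^sub>R d))"
    using dep \<open>\<alpha> \<noteq> 0\<close> by simp
  also have "\<dots> = (- (\<beta> / \<alpha>)) *\<^sub>R b + (- (\<gamma> / \<alpha>)) *\<^sub>R c + (- (\<delta> / \<alpha>)) *\<^sub>R d"
    by (simp add: scaleR_add_right scaleR_diff_right)
  finally have a: "a = \<dots>" .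
  have "(- (\<beta> / \<alpha>)) + (- (\<gamma> / \<alpha>)) + (- (\<delta> / \<alpha>)) = (- \<beta> - \<gamma> - \<delta>) / \<alpha>"
    by (simp add: diff_divide_distrib)
  also have "- \<beta> - \<gamma> - \<delta> = \<alpha>" using sum by linarith
  finally have "(- (\<beta> / \<alpha>)) + (- (\<gamma> / \<alpha>)) + (- (\<delta> / \<alpha>)) = 1" using \<open>\<alpha> \<noteq> 0\<close> by simp
  moreover have "0 \<le> - (\<beta> / \<alpha>)" "0 \<le> - (\<gamma> / \<alpha>)" "0 \<le> - (\<delta> / \<alpha>)"
    using assms by auto
  ultimately have "a \<in> convex hull {b, c, d}"
    unfolding convex_hull_3 using a by blast
  then show ?thesis
    by (rule hull_redundant)
qed

text \<open>Subtracting \<open>t / \<alpha>\<close> times the dependency removes \<open>a\<close>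
  without changing the point. The coefficients of \<open>c\<close> and \<open>d\<close> can only
  grow, and \<open>t * \<beta> \<le> u * \<alpha>\<close> keeps that of \<open>b\<close>
  nonnegative.\<close>

lemma mem_hull_triangle:
  fixes a b c d :: "'a::real_vector"
  assumes "\<alpha> > 0" "\<gamma> \<le> 0" "\<delta> \<le> 0" and sum: "\<alpha> + \<beta> + \<gamma> + \<delta> = 0"
    and dep: "\<alpha> *\<^sub>R a + \<beta> *\<^sub>R b + \<gamma> *\<^sub>R c + \<delta> *\<^sub>R d = 0"
    and nonneg: "0 \<le> t" "0 \<le> v" "0 \<le> w" and one: "t + u + v + w = 1" and le: "t * \<beta> \<le> u * \<alpha>"
  shows "t *\<^sub>R a + u *\<^sub>R b + v *\<^sub>R c + w *\<^sub>R d \<in> convex hull {b, c, d}"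
proof -
  define s where "s = t / \<alpha>"
  have s: "s \<ge> 0" "t = s * \<alpha>"
    using assms by (auto simp: s_def)
  have "t *\<^sub>R a + u *\<^sub>R b + v *\<^sub>R c + w *\<^sub>R d =
      t *\<^sub>R a + u *\<^sub>R b + v *\<^sub>R c + w *\<^sub>R d - s *\<^sub>R (\<alpha> *\<^sub>R a + \<beta> *\<^sub>R b + \<gamma> *\<^sub>R c + \<delta> *\<^sub>R d)"
    using dep by simp
  also have "\<dots> = (u - s * \<beta>) *\<^sub>R b + (v - s * \<gamma>) *\<^sub>R c + (w - s * \<delta>) *\<^sub>R d"
    by (simp add: s algebra_simps)
  finally have eq: "t *\<^sub>R a + u *\<^sub>R b + v *\<^sub>R c + w *\<^sub>R d = \<dots>" .
  have "u - s * \<beta> \<ge> 0"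
    using le \<open>\<alpha> > 0\<close> by (simp add: s_def field_simps)
  moreover have "v - s * \<gamma> \<ge> 0" "w - s * \<delta> \<ge> 0"
    using s(1) assms by (smt (verit) mult_nonneg_nonpos)+
  moreover have "(u - s * \<beta>) + (v - s * \<gamma>) + (w - s * \<delta>) = 1 - s * (\<alpha> + \<beta> + \<gamma> + \<delta>)"
    using one s(2) by (simp add: algebra_simps)
  ultimately show ?thesis
    unfolding convex_hull_3 eq using sum
    by (intro CollectI exI[of _ "u - s * \<beta>"] exI[of _ "v - s * \<gamma>"] exI[of _ "w - s * \<delta>"]) auto
qed

text \<open>Here the segments \<open>a b\<close> and \<open>c d\<close> cross. Of \<open>a\<close>
  and \<open>b\<close>, the one with the smaller ratio of its weight to its coefficient in the
  dependency can be eliminated.\<close>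

lemma hull_eq_two_triangles:
  fixes a b c d :: "'a::real_vector"
  assumes "\<alpha> > 0" "\<beta> > 0" "\<gamma> \<le> 0" "\<delta> \<le> 0" and sum: "\<alpha> + \<beta> + \<gamma> + \<delta> = 0"
    and dep: "\<alpha> *\<^sub>R a + \<beta> *\<^sub>R b + \<gamma> *\<^sub>R c + \<delta> *\<^sub>R d = 0"
  shows "convex hull {a, b, c, d} = convex hull {a, c, d} \<union> convex hull {b, c, d}"
proof (intro equalityI subsetI)
  fix x assume "x \<in> convex hull {a, b, c, d}"
  then obtain t u v w where *: "0 \<le> t" "0 \<le> u" "0 \<le> v" "0 \<le> w" "t + u + v + w = 1"
    and x: "x = t *\<^sub>R a + u *\<^sub>R b + v *\<^sub>R c + w *\<^sub>R d"
    by (auto simp: convex_hull_4)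
  have "x \<in> convex hull {b, c, d}" if "t * \<beta> \<le> u * \<alpha>"
    unfolding x using mem_hull_triangle[OF assms(1,3,4) sum dep] * that by auto
  moreover have "x \<in> convex hull {a, c, d}" if "u * \<alpha> \<le> t * \<beta>"
    using mem_hull_triangle[OF assms(2-4), of \<alpha> b a c d u v w t] * that sum dep
    unfolding x by (simp add: ac_simps)
  ultimately show "x \<in> convex hull {a, c, d} \<union> convex hull {b, c, d}"
    by fastforce
next
  fix x assume "x \<in> convex hull {a, c, d} \<union> convex hull {b, c, d}"
  then show "x \<in> convex hull {a, b, c, d}"
    using hull_mono[of "{a, c, d}" "{a, b, c, d}" convex] hull_mono[of "{b, c, d}" "{a, b, c, d}" convex]
    by auto
qed

lemma lmeasurable_convex_hull_finite:
  fixes S :: "'a::euclidean_space set"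
  shows "finite S \<Longrightarrow> convex hull S \<in> lmeasurable"
  by (simp add: finite_imp_compact_convex_hull lmeasurable_compact)

lemma measure_two_triangles:
  fixes a b c d :: "real^2"
  assumes "\<alpha> > 0" "\<beta> > 0" "\<gamma> \<le> 0" "\<delta> \<le> 0" and sum: "\<alpha> + \<beta> + \<gamma> + \<delta> = 0"
    and dep: "\<alpha> *\<^sub>R a + \<beta> *\<^sub>R b + \<gamma> *\<^sub>R c + \<delta> *\<^sub>R d = 0"
    and "c \<noteq> d"
  shows "measure lebesgue (convex hull {a, b, c, d}) =
    measure lebesgue (convex hull {a, c, d}) + measure lebesgue (convex hull {b, c, d})"
proof -
  \<comment> \<open>A normal of the line through \<open>c\<close> and \<open>d\<close>. The
    dependency puts \<open>a\<close> and \<open>b\<close> on opposite sides of this line, so the two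
    triangles overlap only in a null set.\<close>
  define n :: "real^2" where "n = vector [c$2 - d$2, d$1 - c$1]"
  define k where "k = n \<bullet> c"
  have k: "n \<bullet> d = k"
    by (simp add: k_def n_def inner_vec_def sum_2 algebra_simps)
  have kc: "n \<bullet> c = k"
    by (simp add: k_def)
  have "n \<noteq> 0"
    using \<open>c \<noteq> d\<close> by (auto simp: n_def vec_eq_iff forall_2)
  have "n \<bullet> (\<alpha> *\<^sub>R a + \<beta> *\<^sub>R b + \<gamma> *\<^sub>R c + \<delta> *\<^sub>R d) - (\<alpha> + \<beta> + \<gamma> + \<delta>) * k = 0"
    using sum dep by simp
  then have 0: "\<alpha> * (n \<bullet> a - k) + \<beta> * (n \<bullet> b - k) = 0"
    by (simp add: inner_add_right k k_def[symmetric] algebra_simps)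
  consider "n \<bullet> a \<le> k" "k \<le> n \<bullet> b" | "n \<bullet> b \<le> k" "k \<le> n \<bullet> a"
  proof (cases "n \<bullet> a \<le> k")
    case True
    then have "\<beta> * (n \<bullet> b - k) \<ge> 0"
      using 0 assms(1) mult_nonneg_nonpos[of \<alpha> "n \<bullet> a - k"] by linarith
    with True that(1) assms(2) show ?thesis by (simp add: zero_le_mult_iff)
  next
    case False
    then have "\<beta> * (n \<bullet> b - k) \<le> 0"
      using 0 assms(1) mult_nonneg_nonneg[of \<alpha> "n \<bullet> a - k"] by linarith
    with False that(2) assms(2) show ?thesis by (simp add: mult_le_0_iff)
  qed
  then have "convex hull {a, c, d} \<inter> convex hull {b, c, d} \<subseteq> {x. n \<bullet> x = k}"
  proof cases
    case 1
    have "convex hull {a, c, d} \<subseteq> {x. n \<bullet> x \<le> k}"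
      using 1 k kc by (intro hull_minimal convex_halfspace_le) auto
    moreover have "convex hull {b, c, d} \<subseteq> {x. n \<bullet> x \<ge> k}"
      using 1 k kc by (intro hull_minimal convex_halfspace_ge) auto
    ultimately show ?thesis by force
  next
    case 2
    have "convex hull {b, c, d} \<subseteq> {x. n \<bullet> x \<le> k}"
      using 2 k kc by (intro hull_minimal convex_halfspace_le) auto
    moreover have "convex hull {a, c, d} \<subseteq> {x. n \<bullet> x \<ge> k}"
      using 2 k kc by (intro hull_minimal convex_halfspace_ge) auto
    ultimately show ?thesis by force
  qed
  moreover have "negligible {x. n \<bullet> x = k}"
    using \<open>n \<noteq> 0\<close> by (simp add: negligible_hyperplane)
  ultimately have "negligible (convex hull {a, c, d} \<inter> convex hull {b, c, d})"
    using negligible_subset by blast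
  then have "measure lebesgue (convex hull {a, c, d} \<inter> convex hull {b, c, d}) = 0"
    by (rule negligible_imp_measure0)
  then show ?thesis
    unfolding hull_eq_two_triangles[OF assms(1-6)]
    using measure_Un3[OF lmeasurable_convex_hull_finite lmeasurable_convex_hull_finite, of "{a,c,d}" "{b,c,d}"]
    by simp
qed

text \<open>Twice the signed area of the triangle.\<close>

definition tri_det :: "real^2 \<Rightarrow> real^2 \<Rightarrow> real^2 \<Rightarrow> real" where
  "tri_det a b c = (b$1 - a$1) * (c$2 - a$2) - (c$1 - a$1) * (b$2 - a$2)"

lemma measure_triangle: "measure lebesgue (convex hull {a, b, c}) = \<bar>tri_det a b c\<bar> / 2"
proof -
  have "measure lebesgue (convex hull {a, b, c}) = measure lborel (convex hull {a, b, c})"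
    by (simp add: measure_completion borel_compact finite_imp_compact_convex_hull)
  also have "\<dots> = \<bar>tri_det a b c\<bar> / 2"
    unfolding content_triangle tri_det_def by (simp add: algebra_simps)
  finally show ?thesis .
qed

text \<open>The affine dependency of four points in the plane has the signed areas of the triangles they
  span as coefficients; its sign pattern decides whether one point lies in the triangle of the others
  or two of the segments cross, and in either case the four triangles cover the hull twice.\<close>

lemma measure_hull_four_points:
  fixes a b c d :: "real^2"
  assumes nz: "tri_det b c d \<noteq> 0 \<or> tri_det a c d \<noteq> 0 \<or> tri_det a b d \<noteq> 0 \<or> tri_det a b c \<noteq> 0"
  shows "measure lebesgue (convex hull {a, b, c, d}) =
    (\<bar>tri_det b c d\<bar> + \<bar>tri_det a c d\<bar> + \<bar>tri_det a b d\<bar> + \<bar>tri_det a b c\<bar>) / 4"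
proof -
  define \<alpha> where "\<alpha> = tri_det b c d"
  define \<beta> where "\<beta> = - tri_det a c d"
  define \<gamma> where "\<gamma> = tri_det a b d"
  define \<delta> where "\<delta> = - tri_det a b c"
  let ?m = "\<lambda>S. measure lebesgue (convex hull S)"
  have sum: "\<alpha> + \<beta> + \<gamma> + \<delta> = 0"
    by (simp add: \<alpha>_def \<beta>_def \<gamma>_def \<delta>_def tri_det_def algebra_simps)
  have dep: "\<alpha> *\<^sub>R a + \<beta> *\<^sub>R b + \<gamma> *\<^sub>R c + \<delta> *\<^sub>R d = 0"
    by (simp add: vec_eq_iff forall_2 \<alpha>_def \<beta>_def \<gamma>_def \<delta>_def tri_det_def algebra_simps)
  have m: "?m {b, c, d} = \<bar>\<alpha>\<bar> / 2" "?m {a, c, d} = \<bar>\<beta>\<bar> / 2" "?m {a, b, d} = \<bar>\<gamma>\<bar> / 2" "?m {a, b, c} = \<bar>\<delta>\<bar> / 2"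
    by (simp_all add: measure_triangle \<alpha>_def \<beta>_def \<gamma>_def \<delta>_def)
  have nz': "\<alpha> \<noteq> 0 \<or> \<beta> \<noteq> 0 \<or> \<gamma> \<noteq> 0 \<or> \<delta> \<noteq> 0"
    using nz by (simp add: \<alpha>_def \<beta>_def \<gamma>_def \<delta>_def)
  \<comment> \<open>The coefficients sum to zero and do not all vanish, so one, two or three of them
    are positive. One or three positive ones give a coefficient opposed to all others, two give a
    crossing. Weak inequalities absorb the collinear triples.\<close>
  consider (a) "\<alpha> \<noteq> 0" "\<beta> / \<alpha> \<le> 0" "\<gamma> / \<alpha> \<le> 0" "\<delta> / \<alpha> \<le> 0"
    | (b) "\<beta> \<noteq> 0" "\<alpha> / \<beta> \<le> 0" "\<gamma> / \<beta> \<le> 0" "\<delta> / \<beta> \<le> 0"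
    | (c) "\<gamma> \<noteq> 0" "\<alpha> / \<gamma> \<le> 0" "\<beta> / \<gamma> \<le> 0" "\<delta> / \<gamma> \<le> 0"
    | (d) "\<delta> \<noteq> 0" "\<alpha> / \<delta> \<le> 0" "\<beta> / \<delta> \<le> 0" "\<gamma> / \<delta> \<le> 0"
    | (ab) "\<alpha> > 0" "\<beta> > 0" "\<gamma> \<le> 0" "\<delta> \<le> 0"
    | (ac) "\<alpha> > 0" "\<gamma> > 0" "\<beta> \<le> 0" "\<delta> \<le> 0"
    | (ad) "\<alpha> > 0" "\<delta> > 0" "\<beta> \<le> 0" "\<gamma> \<le> 0"
    | (bc) "\<beta> > 0" "\<gamma> > 0" "\<alpha> \<le> 0" "\<delta> \<le> 0"
    | (bd) "\<beta> > 0" "\<delta> > 0" "\<alpha> \<le> 0" "\<gamma> \<le> 0"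
    | (cd) "\<gamma> > 0" "\<delta> > 0" "\<alpha> \<le> 0" "\<beta> \<le> 0"
    unfolding divide_le_0_iff using nz' sum by (smt (verit))
  then have "?m {a, b, c, d} = (\<bar>\<alpha>\<bar> + \<bar>\<beta>\<bar> + \<bar>\<gamma>\<bar> + \<bar>\<delta>\<bar>) / 4"
  proof cases
    case a
    have "convex hull {a, b, c, d} = convex hull {b, c, d}"
      using hull_eq_triangle[OF a, of a b c d] sum dep by (simp add: insert_commute ac_simps)
    \<comment> \<open>By the zero sum, the other three absolute values add up to |\<alpha>|, so the
      total is twice |\<alpha>|.\<close>
    then show ?thesis using sum a m by (auto simp: divide_le_0_iff)
  next
    case b
    have "convex hull {a, b, c, d} = convex hull {a, c, d}"
      using hull_eq_triangle[OF b, of b a c d] sum dep by (simp add: insert_commute ac_simps)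
    then show ?thesis using sum b m by (auto simp: divide_le_0_iff)
  next
    case c
    have "convex hull {a, b, c, d} = convex hull {a, b, d}"
      using hull_eq_triangle[OF c, of c a b d] sum dep by (simp add: insert_commute ac_simps)
    then show ?thesis using sum c m by (auto simp: divide_le_0_iff)
  next
    case d
    have "convex hull {a, b, c, d} = convex hull {a, b, c}"
      using hull_eq_triangle[OF d, of d a b c] sum dep by (simp add: insert_commute ac_simps)
    then show ?thesis using sum d m by (auto simp: divide_le_0_iff)
  next
    case ab
    then have "c \<noteq> d"
      by (auto simp: \<alpha>_def \<beta>_def \<gamma>_def \<delta>_def tri_det_def)
    then show ?thesis
      using measure_two_triangles[OF ab, of a b c d] sum dep ab m
      by (simp add: insert_commute ac_simps)
  next
    case ac
    then have "b \<noteq> d"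
      by (auto simp: \<alpha>_def \<beta>_def \<gamma>_def \<delta>_def tri_det_def)
    then show ?thesis
      using measure_two_triangles[OF ac, of a c b d] sum dep ac m
      by (simp add: insert_commute ac_simps)
  next
    case ad
    then have "b \<noteq> c"
      by (auto simp: \<alpha>_def \<beta>_def \<gamma>_def \<delta>_def tri_det_def)
    then show ?thesis
      using measure_two_triangles[OF ad, of a d b c] sum dep ad m
      by (simp add: insert_commute ac_simps)
  next
    case bc
    then have "a \<noteq> d"
      by (auto simp: \<alpha>_def \<beta>_def \<gamma>_def \<delta>_def tri_det_def)
    then show ?thesis
      using measure_two_triangles[OF bc, of b c a d] sum dep bc m
      by (simp add: insert_commute ac_simps)
  next
    case bd
    then have "a \<noteq> c"
      by (auto simp: \<alpha>_def \<beta>_def \<gamma>_def \<delta>_def tri_det_def)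
    then show ?thesis
      using measure_two_triangles[OF bd, of b d a c] sum dep bd m
      by (simp add: insert_commute ac_simps)
  next
    case cd
    then have "a \<noteq> b"
      by (auto simp: \<alpha>_def \<beta>_def \<gamma>_def \<delta>_def tri_det_def)
    then show ?thesis
      using measure_two_triangles[OF cd, of c d a b] sum dep cd m
      by (simp add: insert_commute ac_simps)
  qed
  then show ?thesis
    by (simp add: \<alpha>_def \<beta>_def \<gamma>_def \<delta>_def)
qed

subsection \<open>The brightness of the tetrahedron\<close>

lemma sum_1_4: "sum f {1..4::nat} = f 1 + f 2 + f 3 + f 4"
  by (simp add: eval_nat_numeral sum.atLeast_Suc_atMost add.assoc)

lemma atLeastAtMost_1_4: "{1..4::nat} = {1, 2, 3, 4}"
  by auto

lemma xi_simps: "xi 1 = vector [1, 1, 1]" "xi 2 = vector [1, -1, -1]" "xi 3 = vector [-1, 1, -1]"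
  "xi 4 = vector [-1, -1, 1]"
  by (simp_all add: xi_def)

lemma inner_3: "(x :: real^3) \<bullet> y = x$1 * y$1 + x$2 * y$2 + x$3 * y$3"
  by (simp add: inner_vec_def sum_3)

lemma xi_inner:
  assumes "i \<in> {1..4}" "j \<in> {1..4}"
  shows "xi i \<bullet> xi j = (if i = j then 3 else -1)"
  using assms unfolding atLeastAtMost_1_4 by (auto simp: xi_def inner_3)

lemma sum_xi: "(\<Sum>i\<in>{1..4}. xi i) = 0"
  unfolding sum_1_4 xi_simps by (simp add: vec_eq_iff forall_3)

lemma xi_frame: "(\<Sum>i\<in>{1..4}. (xi i \<bullet> x) *\<^sub>R xi i) = 4 *\<^sub>R x"
  unfolding sum_1_4 xi_simps by (simp add: vec_eq_iff forall_3 inner_3)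

section \<open>Orthonormal coordinates on the plane orthogonal to a direction\<close>

lemma plane_isometry_inner:
  assumes "plane_isometry u f"
  shows "f x \<bullet> f y = x \<bullet> y"
proof -
  have "f x + f y = f (x + y)" and n: "\<And>z. norm (f z) = norm z"
    using assms by (auto simp: plane_isometry_def linear_add)
  then show ?thesis
    unfolding dot_norm by (simp only: n)
qed

lemma plane_isometry_orthogonal:
  assumes "plane_isometry u f"
  shows "u \<bullet> f y = 0"
  using assms unfolding plane_isometry_def orth_compl_def by blast

text \<open>The map on the right is the adjoint of \<open>f\<close>: it inverts \<open>f\<close> and
  kills \<open>u\<close>. A preimage of a projection thereby becomes a linear image, which commutes
  with convex hulls.\<close>

lemma vimage_proj_along:
  assumes f: "plane_isometry u f" and "u \<noteq> 0"
  shows "f -` (proj_along u ` K) = (\<lambda>x. vector [f (axis 1 1) \<bullet> x, f (axis 2 1) \<bullet> x]) ` K"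
    (is "_ = ?g ` K")
proof -
  have ortho: "f y \<bullet> u = 0" for y
    using plane_isometry_orthogonal[OF f] by (simp add: inner_commute)
  have g: "y = ?g x" if "f y = proj_along u x" for x y
  proof -
    have "y $ i = f (axis i 1) \<bullet> x" for i
    proof -
      have "y $ i = f (axis i 1) \<bullet> f y"
        by (simp add: plane_isometry_inner[OF f] inner_axis')
      also have "\<dots> = f (axis i 1) \<bullet> x"
        by (simp add: that proj_along_def inner_diff_right ortho)
      finally show ?thesis .
    qed
    then show ?thesis by (simp add: vec_eq_iff forall_2)
  qed
  moreover have "f (?g x) = proj_along u x" for x
  proof -
    have "proj_along u x \<in> orth_compl u"
      using \<open>u \<noteq> 0\<close> by (simp add: orth_compl_def proj_along_def inner_diff_right)
    then obtain y where "f y = proj_along u x"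
      using f unfolding plane_isometry_def by (metis imageE)
    then show ?thesis using g[OF \<open>f y = proj_along u x\<close>] by simp
  qed
  ultimately show ?thesis by blast
qed

text \<open>The images of the two axes are orthonormal and orthogonal to \<open>u\<close>, so their
  cross product is \<open>u\<close> or \<open>- u\<close>. The sign depends on the orientation of
  \<open>f\<close>, hence the absolute values.\<close>

lemma inner_cross3_plane_isometry:
  assumes f: "plane_isometry u f" and "norm u = 1"
  shows "\<bar>cross3 (f (axis 1 1)) (f (axis 2 1)) \<bullet> x\<bar> = \<bar>u \<bullet> x\<bar>"
proof -
  let ?e1 = "f (axis 1 1)" and ?e2 = "f (axis 2 1)"
  let ?w = "cross3 ?e1 ?e2"
  note ortho = plane_isometry_orthogonal[OF f]
  have n: "norm ?e1 = 1" "norm ?e2 = 1" "?e1 \<bullet> ?e2 = 0"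
    using f by (simp_all add: plane_isometry_def plane_isometry_inner[OF f] norm_axis_1 inner_axis_axis)
  have "(norm ?w)\<^sup>2 = 1"
    using norm_cross_dot[of ?e1 ?e2] n by simp
  then have w: "norm ?w = 1"
    by (simp add: power2_eq_1_iff) (use norm_ge_zero[of ?w] in linarith)
  have "cross3 u ?w = 0"
    by (simp add: Lagrange ortho)
  then have "collinear {0, u, ?w}"
    by (simp add: cross_eq_0)
  moreover have "u \<noteq> 0" "?w \<noteq> 0"
    using w \<open>norm u = 1\<close> by auto
  ultimately obtain c where c: "?w = c *\<^sub>R u"
    unfolding collinear_lemma by blast
  then have "\<bar>c\<bar> = 1"
    using w \<open>norm u = 1\<close> by simp
  then show ?thesis
    by (simp add: c abs_mult)
qed

lemma tri_det_scaleR: "tri_det (k *\<^sub>R a) (k *\<^sub>R b) (k *\<^sub>R c) = k\<^sup>2 * tri_det a b c"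
  by (simp add: tri_det_def power2_eq_square algebra_simps)

text \<open>The Binet-Cauchy identity: the signed area of a projected triangle is read off from the
  area vector of the triangle in space.\<close>

lemma tri_det_coords:
  "tri_det (vector [v \<bullet> a, w \<bullet> a]) (vector [v \<bullet> b, w \<bullet> b]) (vector [v \<bullet> c, w \<bullet> c]) =
    cross3 v w \<bullet> cross3 (b - a) (c - a)"
proof -
  have "tri_det (vector [v \<bullet> a, w \<bullet> a]) (vector [v \<bullet> b, w \<bullet> b]) (vector [v \<bullet> c, w \<bullet> c]) =
    (v \<bullet> (b - a)) * (w \<bullet> (c - a)) - (v \<bullet> (c - a)) * (w \<bullet> (b - a))"
    by (simp add: tri_det_def inner_diff_right)
  also have "\<dots> = cross3 v w \<bullet> cross3 (b - a) (c - a)"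
    by (simp add: dot_cross)
  finally show ?thesis .
qed

lemma brightness_T_body:
  assumes "norm u = 1"
  shows "brightness T_body u = (\<Sum>i\<in>{1..4}. \<bar>u \<bullet> xi i\<bar>) / 8"
proof -
  have "u \<noteq> 0"
    using assms by auto
  obtain f where f: "plane_isometry u f"
    using plane_isometry_exists[OF \<open>u \<noteq> 0\<close>] by blast
  let ?e1 = "f (axis 1 1)" and ?e2 = "f (axis 2 1)"
  define w where "w = cross3 ?e1 ?e2"
  define g :: "real^3 \<Rightarrow> real^2" where "g = (\<lambda>x. vector [?e1 \<bullet> x, ?e2 \<bullet> x])"
  have "linear g"
    unfolding g_def by (rule linearI) (simp_all add: vec_eq_iff forall_2 inner_add_right)
  define p where "p i = g ((1 / sqrt 8) *\<^sub>R xi i)" for i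
  have "f -` (proj_along u ` T_body) = convex hull (p ` {1..4})"
    unfolding vimage_proj_along[OF f \<open>u \<noteq> 0\<close>] T_body_def g_def[symmetric]
    by (simp add: convex_hull_linear_image[OF \<open>linear g\<close>] p_def image_image)
  then have pre: "f -` (proj_along u ` T_body) = convex hull {p 1, p 2, p 3, p 4}"
    unfolding atLeastAtMost_1_4 by simp
  have p: "p i = (1 / sqrt 8) *\<^sub>R g (xi i)" for i
    unfolding p_def by (rule linear_scale[OF \<open>linear g\<close>])
  have det: "tri_det (p i) (p j) (p k) = w \<bullet> cross3 (xi j - xi i) (xi k - xi i) / 8" for i j k
    unfolding p tri_det_scaleR w_def g_def tri_det_coords by (simp add: power_divide)
  \<comment> \<open>The facet opposite a vertex of the tetrahedron is orthogonal to that vertex. The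
    signs alternate because omitting successive indices reverses the orientation.\<close>
  have "cross3 (xi 3 - xi 2) (xi 4 - xi 2) = 4 *\<^sub>R xi 1" "cross3 (xi 3 - xi 1) (xi 4 - xi 1) = - 4 *\<^sub>R xi 2"
    "cross3 (xi 2 - xi 1) (xi 4 - xi 1) = 4 *\<^sub>R xi 3" "cross3 (xi 2 - xi 1) (xi 3 - xi 1) = - 4 *\<^sub>R xi 4"
    unfolding xi_simps cross3_def by (simp_all add: vec_eq_iff forall_3)
  then have dets: "tri_det (p 2) (p 3) (p 4) = (w \<bullet> xi 1) / 2" "tri_det (p 1) (p 3) (p 4) = - (w \<bullet> xi 2) / 2"
    "tri_det (p 1) (p 2) (p 4) = (w \<bullet> xi 3) / 2" "tri_det (p 1) (p 2) (p 3) = - (w \<bullet> xi 4) / 2"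
    by (simp_all add: det)
  have abs: "\<bar>w \<bullet> x\<bar> = \<bar>u \<bullet> x\<bar>" for x
    unfolding w_def using inner_cross3_plane_isometry[OF f assms] .
  \<comment> \<open>At least one facet projects to a nondegenerate triangle, since the frame
    identity leaves no nonzero vector orthogonal to all \<open>xi i\<close>.\<close>
  have "\<exists>i\<in>{1..4}. w \<bullet> xi i \<noteq> 0"
  proof (rule ccontr)
    assume "\<not> ?thesis"
    then have "xi i \<bullet> u = 0" if "i \<in> {1..4}" for i
      using that abs[of "xi i"] by (simp add: inner_commute)
    then have "4 *\<^sub>R u = 0"
      unfolding xi_frame[symmetric] by simp
    then show False using \<open>u \<noteq> 0\<close> by simp
  qed
  then have "tri_det (p 2) (p 3) (p 4) \<noteq> 0 \<or> tri_det (p 1) (p 3) (p 4) \<noteq> 0 \<or>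
      tri_det (p 1) (p 2) (p 4) \<noteq> 0 \<or> tri_det (p 1) (p 2) (p 3) \<noteq> 0"
    unfolding dets atLeastAtMost_1_4 by auto
  from measure_hull_four_points[OF this]
  have "measure lebesgue (convex hull {p 1, p 2, p 3, p 4}) = (\<Sum>i\<in>{1..4}. \<bar>u \<bullet> xi i\<bar>) / 8"
    by (simp add: dets abs sum_1_4 del: One_nat_def)
  moreover have "f -` (proj_along u ` T_body) \<in> lmeasurable"
    unfolding pre by (simp add: lmeasurable_convex_hull_finite)
  ultimately show ?thesis
    unfolding brightness_def using plane_area_eq[OF f, of "proj_along u ` T_body"] pre by simp
qed

subsection \<open>The zonotope and its facets\<close>

declare One_nat_def [simp del]

text \<open>A free \<open>r\<close> covers both bodies: \<open>1/16\<close> gives \<open>Z_T\<close>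
  and \<open>sqrt 3 / 6\<close> gives \<open>R_body\<close>.\<close>

definition zono :: "real \<Rightarrow> (real^3) set" where
  "zono r = (\<Sum>i\<in>{1..4}. closed_segment (- (r *\<^sub>R xi i)) (r *\<^sub>R xi i))"

lemma closed_segment_symmetric:
  fixes v :: "'a::real_vector"
  assumes "r \<ge> 0"
  shows "closed_segment (- (r *\<^sub>R v)) (r *\<^sub>R v) = {t *\<^sub>R v | t. \<bar>t\<bar> \<le> r}"
proof -
  have "closed_segment ((- r) *\<^sub>R v) (r *\<^sub>R v) = (\<lambda>t. t *\<^sub>R v) ` closed_segment (- r) r"
    by (rule closed_segment_linear_image) (simp add: linear_scale_left)
  then show ?thesis
    using assms by (auto simp: closed_segment_eq_real_ivl abs_le_iff)
qed

lemma mem_zono_iff_sum: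
  assumes "r \<ge> 0"
  shows "x \<in> zono r \<longleftrightarrow> (\<exists>t. (\<forall>i\<in>{1..4}. \<bar>t i\<bar> \<le> r) \<and> x = (\<Sum>i\<in>{1..4}. t i *\<^sub>R xi i))"
proof -
  have "x \<in> zono r \<longleftrightarrow> (\<exists>s. (\<forall>i\<in>{1..4}. s i \<in> {t *\<^sub>R xi i | t. \<bar>t\<bar> \<le> r}) \<and> x = sum s {1..4})"
    unfolding zono_def closed_segment_symmetric[OF assms] by (subst set_sum_alt) auto
  also have "\<dots> \<longleftrightarrow> (\<exists>t. (\<forall>i\<in>{1..4}. \<bar>t i\<bar> \<le> r) \<and> x = (\<Sum>i\<in>{1..4}. t i *\<^sub>R xi i))"
  proof
    assume "\<exists>s. (\<forall>i\<in>{1..4}. s i \<in> {t *\<^sub>R xi i | t. \<bar>t\<bar> \<le> r}) \<and> x = sum s {1..4}"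
    then obtain s where s: "\<forall>i\<in>{1..4}. \<exists>t. s i = t *\<^sub>R xi i \<and> \<bar>t\<bar> \<le> r" and x: "x = sum s {1..4}"
      by auto
    from bchoice[OF s] obtain t where "\<forall>i\<in>{1..4}. s i = t i *\<^sub>R xi i \<and> \<bar>t i\<bar> \<le> r"
      by blast
    then show "\<exists>t. (\<forall>i\<in>{1..4}. \<bar>t i\<bar> \<le> r) \<and> x = (\<Sum>i\<in>{1..4}. t i *\<^sub>R xi i)"
      unfolding x by (intro exI[of _ t]) (auto intro: sum.cong)
  next
    assume "\<exists>t. (\<forall>i\<in>{1..4}. \<bar>t i\<bar> \<le> r) \<and> x = (\<Sum>i\<in>{1..4}. t i *\<^sub>R xi i)"
    then obtain t where "\<forall>i\<in>{1..4}. \<bar>t i\<bar> \<le> r" "x = (\<Sum>i\<in>{1..4}. t i *\<^sub>R xi i)"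
      by blast
    then show "\<exists>s. (\<forall>i\<in>{1..4}. s i \<in> {t *\<^sub>R xi i | t. \<bar>t\<bar> \<le> r}) \<and> x = sum s {1..4}"
      by (intro exI[of _ "\<lambda>i. t i *\<^sub>R xi i"]) auto
  qed
  finally show ?thesis .
qed

text \<open>Each row of the Gram matrix is 4 times a unit vector minus the all-ones vector. The
  latter contributes the total of the coefficients, which cancels in the difference.\<close>

lemma inner_diff_xi_sum:
  assumes "i \<in> {1..4}" "j \<in> {1..4}"
  shows "(xi i - xi j) \<bullet> (\<Sum>k\<in>{1..4}. t k *\<^sub>R xi k) = 4 * (t i - t j)"
proof -
  have "xi l \<bullet> (\<Sum>k\<in>{1..4}. t k *\<^sub>R xi k) = 4 * t l - (\<Sum>k\<in>{1..4}. t k)" if l: "l \<in> {1..4}" for l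
  proof -
    have "xi l \<bullet> (\<Sum>k\<in>{1..4}. t k *\<^sub>R xi k) = (\<Sum>k\<in>{1..4}. t k * (if l = k then 3 else -1))"
      unfolding inner_sum_right by (intro sum.cong) (simp_all add: xi_inner l del: atLeastAtMost_iff)
    also have "\<dots> = (\<Sum>k\<in>{1..4}. (if k = l then 4 * t k else 0) - t k)"
      by (intro sum.cong) auto
    also have "\<dots> = 4 * t l - (\<Sum>k\<in>{1..4}. t k)"
      using l by (simp add: sum_subtractf)
    finally show ?thesis .
  qed
  with assms show ?thesis
    by (simp add: inner_diff_left)
qed

text \<open>Adding a constant to all four coefficients of a combination of the \<open>xi i\<close> does not change it,
  so membership only depends on their spread, which is read off from the inner products.\<close>

lemma mem_zono_iff_halfspaces:
  assumes "r \<ge> 0"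
  shows "x \<in> zono r \<longleftrightarrow> (\<forall>i\<in>{1..4}. \<forall>j\<in>{1..4}. (xi i - xi j) \<bullet> x \<le> 8 * r)"
proof
  assume "x \<in> zono r"
  then obtain t where t: "\<forall>i\<in>{1..4}. \<bar>t i\<bar> \<le> r" and x: "x = (\<Sum>i\<in>{1..4}. t i *\<^sub>R xi i)"
    unfolding mem_zono_iff_sum[OF assms] by blast
  have "4 * (t i - t j) \<le> 8 * r" if "i \<in> {1..4}" "j \<in> {1..4}" for i j
    using t[rule_format, OF that(1)] t[rule_format, OF that(2)] by (simp add: abs_le_iff)
  then show "\<forall>i\<in>{1..4}. \<forall>j\<in>{1..4}. (xi i - xi j) \<bullet> x \<le> 8 * r"
    unfolding x by (intro ballI) (simp only: inner_diff_xi_sum)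
next
  assume *: "\<forall>i\<in>{1..4}. \<forall>j\<in>{1..4}. (xi i - xi j) \<bullet> x \<le> 8 * r"
  define c where "c i = xi i \<bullet> x" for i
  define M where "M = Max (c ` {1..4})"
  define m where "m = Min (c ` {1..4})"
  \<comment> \<open>Subtracting the midrange centres the coefficients, so each is bounded by half
    the spread; the division by 4 undoes the frame constant.\<close>
  define t where "t i = (c i - (M + m) / 2) / 4" for i
  have "M \<in> c ` {1..4}" "m \<in> c ` {1..4}"
    unfolding M_def m_def by (rule Max_in Min_in; simp)+
  then have "M - m \<le> 8 * r"
    using * by (auto simp: c_def inner_diff_left)
  moreover have "m \<le> c i" "c i \<le> M" if "i \<in> {1..4}" for i
    using that by (simp_all add: M_def m_def)
  ultimately have "\<bar>t i\<bar> \<le> r" if "i \<in> {1..4}" for i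
    using that by (fastforce simp: t_def abs_le_iff field_simps)
  moreover have "(\<Sum>i\<in>{1..4}. t i *\<^sub>R xi i) =
      (1/4) *\<^sub>R (\<Sum>i\<in>{1..4}. (xi i \<bullet> x) *\<^sub>R xi i) - ((M + m) / 8) *\<^sub>R (\<Sum>i\<in>{1..4}. xi i)"
    unfolding scaleR_sum_right sum_subtractf[symmetric]
    by (intro sum.cong) (simp_all add: t_def c_def diff_divide_distrib scaleR_diff_left)
  then have "(\<Sum>i\<in>{1..4}. t i *\<^sub>R xi i) = x"
    unfolding sum_xi xi_frame by simp
  ultimately show "x \<in> zono r"
    unfolding mem_zono_iff_sum[OF assms] by (intro exI[of _ t]) simp
qed

lemma norm_xi: "i \<in> {1..4} \<Longrightarrow> norm (xi i) = sqrt 3"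
  by (simp add: norm_eq_sqrt_inner xi_inner)

lemma norm_xi_diff: "i \<in> {1..4} \<Longrightarrow> j \<in> {1..4} \<Longrightarrow> i \<noteq> j \<Longrightarrow> norm (xi i - xi j) = 2 * sqrt 2"
  by (rule power2_eq_imp_eq)
    (simp_all add: power2_norm_eq_inner xi_inner inner_diff_left inner_diff_right power_mult_distrib)

lemma norm_xi_add: "i \<in> {1..4} \<Longrightarrow> j \<in> {1..4} \<Longrightarrow> i \<noteq> j \<Longrightarrow> norm (xi i + xi j) = 2"
  by (rule power2_eq_imp_eq)
    (simp_all add: power2_norm_eq_inner xi_inner inner_add_left inner_add_right)

lemma zono_hull: "zono r = convex hull (\<Sum>i\<in>{1..4}. {- (r *\<^sub>R xi i), r *\<^sub>R xi i})"
  unfolding convex_hull_set_sum zono_def by (simp add: segment_convex_hull)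

lemma polytope_zono: "polytope (zono r)"
  unfolding zono_hull by (intro polytope_convex_hull finite_set_sum) auto

lemma interior_zono:
  assumes "r > 0"
  shows "interior (zono r) \<noteq> {}"
proof -
  \<comment> \<open>The facet normals have norm at most 4, so Cauchy-Schwarz bounds every inner
    product by \<open>8 * r\<close>.\<close>
  have "ball 0 (2 * r) \<subseteq> zono r"
  proof
    fix x :: "real^3" assume "x \<in> ball 0 (2 * r)"
    then have x: "norm x \<le> 2 * r" by simp
    have "(xi i - xi j) \<bullet> x \<le> 8 * r" if "i \<in> {1..4}" "j \<in> {1..4}" for i j
    proof -
      have "norm (xi i - xi j) \<le> 4"
        using norm_xi_diff[OF that] real_sqrt_le_mono[of 2 4] assms by (cases "i = j") auto
      then have "norm (xi i - xi j) * norm x \<le> 4 * (2 * r)"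
        using x assms by (intro mult_mono) auto
      then show ?thesis
        using norm_cauchy_schwarz[of "xi i - xi j" x] by linarith
    qed
    then show "x \<in> zono r"
      using assms by (simp add: mem_zono_iff_halfspaces)
  qed
  then have "ball 0 (2 * r) \<subseteq> interior (zono r)"
    by (simp add: interior_maximal)
  then show ?thesis
    using assms by (metis ball_eq_empty mult_pos_pos not_le subset_empty zero_less_numeral)
qed

lemma aff_dim_zono: "r > 0 \<Longrightarrow> aff_dim (zono r) = 3"
  using aff_dim_nonempty_interior[OF interior_zono] by simp

section \<open>Facets as equality sets of an irredundant system of half-spaces\<close>

definition zono_facet :: "real \<Rightarrow> nat \<times> nat \<Rightarrow> (real^3) set" where
  "zono_facet r = (\<lambda>(i, j). zono r \<inter> {x. (xi i - xi j) \<bullet> x = 8 * r})"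

text \<open>The pairs are ordered because opposite facets have opposite normals. The differences
  \<open>xi i - xi j\<close> are, up to scale, the roots of type A_3.\<close>

definition offdiag :: "(nat \<times> nat) set" where
  "offdiag = {(i, j). i \<in> {1..4} \<and> j \<in> {1..4} \<and> i \<noteq> j}"

text \<open>Distinct normals enclose an angle of at least 60 degrees. The gap between 4 here and the
  squared norm 8 yields points that violate, or attain, exactly one of the inequalities.\<close>

lemma offdiag_inner:
  assumes "(i, j) \<in> offdiag" "(k, l) \<in> offdiag" "(i, j) \<noteq> (k, l)"
  shows "(xi i - xi j) \<bullet> (xi k - xi l) \<le> 4"
  using assms by (auto simp: offdiag_def xi_inner inner_diff_left inner_diff_right)

lemma offdiag_inner_self: "(i, j) \<in> offdiag \<Longrightarrow> (xi i - xi j) \<bullet> (xi i - xi j) = 8"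
  by (auto simp: offdiag_def xi_inner inner_diff_left inner_diff_right)

lemma card_offdiag: "card offdiag = 12" and finite_offdiag: "finite offdiag"
proof -
  have eq: "offdiag = {1..4} \<times> {1..4} - (\<lambda>i. (i, i)) ` {1..4}"
    by (auto simp: offdiag_def)
  show "card offdiag = 12"
    unfolding eq by (subst card_Diff_subset) (auto simp: card_image inj_on_def card_cartesian_product)
  show "finite offdiag"
    unfolding eq by simp
qed

lemma facet_of_zono_iff:
  assumes "r > 0"
  shows "F facet_of zono r \<longleftrightarrow> F \<in> zono_facet r ` offdiag"
proof -
  define h where "h = (\<lambda>(i, j). {x :: real^3. (xi i - xi j) \<bullet> x \<le> 8 * r})"
  \<comment> \<open>Irredundancy. Along a normal, any factor above \<open>r\<close> breaks its own
    inequality, and any factor up to \<open>2 * r\<close> respects the others;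
    \<open>3/2 * r\<close> lies between.\<close>
  have violates: "(3/2 * r) *\<^sub>R (xi i - xi j) \<in> h p \<longleftrightarrow> p \<noteq> (i, j)"
    if "(i, j) \<in> offdiag" "p \<in> offdiag" for i j p
  proof (cases p)
    case (Pair k l)
    have "(3/2 * r) * ((xi k - xi l) \<bullet> (xi i - xi j)) \<le> (3/2 * r) * 4" if "p \<noteq> (i, j)"
      using offdiag_inner[of k l i j] \<open>(i, j) \<in> offdiag\<close> \<open>p \<in> offdiag\<close> that Pair assms
      by (intro mult_left_mono) auto
    moreover have "(3/2 * r) * ((xi k - xi l) \<bullet> (xi i - xi j)) > 8 * r" if "p = (i, j)"
      using offdiag_inner_self[OF \<open>(i, j) \<in> offdiag\<close>] that Pair assms by auto
    ultimately show ?thesis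
      using assms by (auto simp: h_def Pair)
  qed
  then have inj: "inj_on h offdiag"
    by (intro inj_onI) (metis surj_pair)
  \<comment> \<open>The facet criterion takes normals as a function of the half-space itself, so the
    injective indexing \<open>h\<close> is inverted.\<close>
  define n where "n = (\<lambda>S. case inv_into offdiag h S of (i, j) \<Rightarrow> xi i - xi j)"
  have n: "n (h (i, j)) = xi i - xi j" if "(i, j) \<in> offdiag" for i j
    by (simp add: n_def inv_into_f_f[OF inj that])
  have zono: "zono r = \<Inter>(h ` offdiag)"
  proof -
    have "x \<in> zono r \<longleftrightarrow> x \<in> \<Inter>(h ` offdiag)" for x
      unfolding mem_zono_iff_halfspaces[OF less_imp_le[OF assms]] using assms
      by (force simp: h_def offdiag_def)
    then show ?thesis by blast
  qed
  have aff: "affine hull zono r = UNIV"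
    by (rule affine_hull_nonempty_interior[OF interior_zono[OF assms]])
  have "F facet_of zono r \<longleftrightarrow> (\<exists>S. S \<in> h ` offdiag \<and> F = zono r \<inter> {x. n S \<bullet> x = 8 * r})"
  proof (rule facet_of_polyhedron_explicit)
    show "finite (h ` offdiag)"
      by (simp add: finite_offdiag)
    show "zono r = affine hull zono r \<inter> \<Inter>(h ` offdiag)"
      using aff zono by simp
    show "n S \<noteq> 0 \<and> S = {x. n S \<bullet> x \<le> 8 * r}" if S: "S \<in> h ` offdiag" for S
    proof -
      obtain i j where ij: "(i, j) \<in> offdiag" "S = h (i, j)"
        using S by auto
      then have "n S = xi i - xi j"
        using n by simp
      then show ?thesis
        using offdiag_inner_self[OF ij(1)] ij(2) by (auto simp: h_def)
    qed
    show "zono r \<subset> affine hull zono r \<inter> \<Inter>\<S>" if \<S>: "\<S> \<subset> h ` offdiag" for \<S>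
    proof -
      obtain i j where ij: "(i, j) \<in> offdiag" "h (i, j) \<notin> \<S>"
        using \<S> by auto
      have "(3/2 * r) *\<^sub>R (xi i - xi j) \<in> S" if "S \<in> \<S>" for S
        using violates[OF ij(1)] that \<S> ij(2) by blast
      moreover have "(3/2 * r) *\<^sub>R (xi i - xi j) \<notin> zono r"
        using violates[OF ij(1) ij(1)] ij(1) unfolding zono by blast
      ultimately show ?thesis
        unfolding aff using \<S> zono by blast
    qed
  qed
  also have "\<dots> \<longleftrightarrow> F \<in> zono_facet r ` offdiag"
    using n by (force simp: zono_facet_def)
  finally show ?thesis .
qed

lemma card_facets_zono:
  assumes "r > 0"
  shows "card {F. F facet_of zono r} = 12"
proof -
  \<comment> \<open>This point is the centre of its facet and lies in no other, so different pairs
    give different facets.\<close>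
  have "r *\<^sub>R (xi i - xi j) \<in> zono_facet r p \<longleftrightarrow> p = (i, j)"
    if ij: "(i, j) \<in> offdiag" and "p \<in> offdiag" for i j p
  proof (cases p)
    case (Pair k l)
    have "(xi a - xi b) \<bullet> (xi i - xi j) \<le> 8" if "a \<in> {1..4}" "b \<in> {1..4}" for a b
      using offdiag_inner[of a b i j] offdiag_inner_self[of i j] ij that
      by (cases "(a, b) = (i, j)"; cases "a = b") (auto simp: offdiag_def)
    then have "r * ((xi a - xi b) \<bullet> (xi i - xi j)) \<le> r * 8" if "a \<in> {1..4}" "b \<in> {1..4}" for a b
      using that assms by (intro mult_left_mono) auto
    then have "r *\<^sub>R (xi i - xi j) \<in> zono r"
      unfolding mem_zono_iff_halfspaces[OF less_imp_le[OF assms]] by (simp add: mult.commute)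
    moreover have "(xi k - xi l) \<bullet> (xi i - xi j) = 8 \<longleftrightarrow> p = (i, j)"
      using offdiag_inner[of k l i j] offdiag_inner_self[of i j] ij \<open>p \<in> offdiag\<close> Pair by force
    ultimately show ?thesis
      using assms by (auto simp: Pair zono_facet_def)
  qed
  then have "inj_on (zono_facet r) offdiag"
    by (intro inj_onI) (metis surj_pair)
  then show ?thesis
    using card_image[of "zono_facet r" offdiag] by (simp add: facet_of_zono_iff[OF assms] card_offdiag)
qed

section \<open>Facets as rhombi\<close>

lemma convex_hull_parallelogram:
  fixes a v w :: "'a::real_vector"
  shows "convex hull {a, a + v, a + v + w, a + w} = {a + s *\<^sub>R v + t *\<^sub>R w | s t. 0 \<le> s \<and> s \<le> 1 \<and> 0 \<le> t \<and> t \<le> 1}"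
proof -
  \<comment> \<open>Written as a Minkowski sum, because hulls commute with such sums.\<close>
  have "convex hull {a, a + v, a + v + w, a + w} = convex hull ({a} + ({0, v} + {0, w}))"
    by (rule arg_cong[where f = "(hull) convex"]) (auto simp: set_plus_def algebra_simps)
  also have "\<dots> = {a} + (closed_segment 0 v + closed_segment 0 w)"
    by (simp add: convex_hull_set_plus segment_convex_hull)
  also have "\<dots> = {a + s *\<^sub>R v + t *\<^sub>R w | s t. 0 \<le> s \<and> s \<le> 1 \<and> 0 \<le> t \<and> t \<le> 1}"
  proof -
    have seg: "closed_segment 0 z = (\<lambda>s. s *\<^sub>R z) ` {0..1}" for z :: 'a
      by (auto simp: closed_segment_def)
    show ?thesis
      by (auto simp: seg set_plus_def add.assoc Bex_def)
  qed
  finally show ?thesis .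
qed

lemma noncollinear_xi:
  assumes "k \<in> {1..4}" "l \<in> {1..4}" "k \<noteq> l" "c \<noteq> 0" "d \<noteq> 0"
  shows "\<not> collinear {0, c *\<^sub>R xi k, d *\<^sub>R xi l}"
proof
  assume "collinear {0, c *\<^sub>R xi k, d *\<^sub>R xi l}"
  moreover have "xi k \<noteq> 0" "xi l \<noteq> 0"
    using norm_xi assms by fastforce+
  ultimately obtain e where "d *\<^sub>R xi l = e *\<^sub>R (c *\<^sub>R xi k)"
    using assms unfolding collinear_lemma by auto
  \<comment> \<open>The Gram entries turn this into -d = 3ec and 3d = -ec, which forces d =
    0.\<close>
  then have "xi k \<bullet> (d *\<^sub>R xi l) = xi k \<bullet> (e *\<^sub>R (c *\<^sub>R xi k))" "xi l \<bullet> (d *\<^sub>R xi l) = xi l \<bullet> (e *\<^sub>R (c *\<^sub>R xi k))"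
    by simp_all
  then show False
    using assms by (simp add: xi_inner)
qed

text \<open>Equality in the facet inequality pins the coefficients of \<open>xi i\<close> and
  \<open>xi j\<close> to \<open>r\<close> and \<open>- r\<close>. The other two vary freely and span
  the rhombus.\<close>

lemma rhombus_facet:
  assumes "r > 0" and ij: "(i, j) \<in> offdiag"
  shows "rhombus (zono_facet r (i, j)) (sqrt 2 * (4 * r)) (4 * r)"
proof -
  have "i \<in> {1..4}" "j \<in> {1..4}" "i \<noteq> j"
    using ij by (auto simp: offdiag_def)
  then have "card ({1..4} - {i, j}) = 2"
    by (subst card_Diff_subset) auto
  then obtain k l where kl: "{1..4} - {i, j} = {k, l}" "k \<noteq> l"
    by (auto simp: card_2_iff)
  then have I: "{1..4} = {i, j, k, l}" and mem: "k \<in> {1..4}" "l \<in> {1..4}" and "k \<noteq> i" "k \<noteq> j" "l \<noteq> i" "l \<noteq> j"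
    using \<open>i \<in> {1..4}\<close> \<open>j \<in> {1..4}\<close> by blast+
  then have sum: "(\<Sum>m\<in>{1..4}. f m) = f i + f j + f k + f l" for f :: "nat \<Rightarrow> real^3"
    unfolding I using \<open>k \<noteq> l\<close> \<open>i \<noteq> j\<close> by (simp add: add.assoc)
  define v where "v = (2 * r) *\<^sub>R xi k"
  \<comment> \<open>The minus sign makes \<open>v + w\<close> the longer diagonal, parallel to
    \<open>xi k - xi l\<close>. Accordingly the corner \<open>a\<close> starts with coefficient
    \<open>- r\<close> at \<open>xi k\<close> and \<open>r\<close> at \<open>xi l\<close>.\<close>
  define w where "w = (- 2 * r) *\<^sub>R xi l"
  define a where "a = r *\<^sub>R xi i - r *\<^sub>R xi j - r *\<^sub>R xi k + r *\<^sub>R xi l"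
  have facet: "zono_facet r (i, j) = convex hull {a, a + v, a + v + w, a + w}"
    unfolding convex_hull_parallelogram
  proof (intro equalityI subsetI)
    fix x assume "x \<in> zono_facet r (i, j)"
    then have "x \<in> zono r" and 8: "(xi i - xi j) \<bullet> x = 8 * r"
      by (auto simp: zono_facet_def)
    then obtain t where t: "\<forall>m\<in>{1..4}. \<bar>t m\<bar> \<le> r" and x: "x = (\<Sum>m\<in>{1..4}. t m *\<^sub>R xi m)"
      unfolding mem_zono_iff_sum[OF less_imp_le[OF assms(1)]] by blast
    have "t i - t j = 2 * r"
      using 8 unfolding x by (simp add: inner_diff_xi_sum \<open>i \<in> {1..4}\<close> \<open>j \<in> {1..4}\<close> del: atLeastAtMost_iff)
    moreover have b: "\<bar>t i\<bar> \<le> r" "\<bar>t j\<bar> \<le> r" "\<bar>t k\<bar> \<le> r" "\<bar>t l\<bar> \<le> r"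
      using t \<open>i \<in> {1..4}\<close> \<open>j \<in> {1..4}\<close> mem by blast+
    ultimately have "t i = r" "t j = - r"
      by linarith+
    then have "x = a + ((t k + r) / (2 * r)) *\<^sub>R v + ((r - t l) / (2 * r)) *\<^sub>R w"
    proof -
      have "((t k + r) / (2 * r)) *\<^sub>R v = (t k + r) *\<^sub>R xi k" "((r - t l) / (2 * r)) *\<^sub>R w = (t l - r) *\<^sub>R xi l"
        using assms(1) by (simp_all add: v_def w_def flip: minus_mult_right) (simp add: algebra_simps)
      then show ?thesis
        unfolding x sum by (simp add: a_def \<open>t i = r\<close> \<open>t j = - r\<close> algebra_simps)
    qed
    moreover have "0 \<le> (t k + r) / (2 * r)" "(t k + r) / (2 * r) \<le> 1" "0 \<le> (r - t l) / (2 * r)" "(r - t l) / (2 * r) \<le> 1"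
      using b assms(1) by (auto simp: field_simps abs_le_iff)
    ultimately show "x \<in> {a + s *\<^sub>R v + t *\<^sub>R w | s t. 0 \<le> s \<and> s \<le> 1 \<and> 0 \<le> t \<and> t \<le> 1}"
      by blast
  next
    fix x assume "x \<in> {a + s *\<^sub>R v + t *\<^sub>R w | s t. 0 \<le> s \<and> s \<le> 1 \<and> 0 \<le> t \<and> t \<le> 1}"
    then obtain p q where x: "x = a + p *\<^sub>R v + q *\<^sub>R w" and pq: "0 \<le> p" "p \<le> 1" "0 \<le> q" "q \<le> 1"
      by blast
    define t where "t m = (if m = i then r else if m = j then - r else if m = k then (2 * p - 1) * r
      else (1 - 2 * q) * r)" for m
    have tx: "x = (\<Sum>m\<in>{1..4}. t m *\<^sub>R xi m)"
      unfolding sum using \<open>i \<noteq> j\<close> \<open>k \<noteq> l\<close> \<open>k \<noteq> i\<close> \<open>k \<noteq> j\<close> \<open>l \<noteq> i\<close> \<open>l \<noteq> j\<close>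
      by (simp add: x a_def v_def w_def t_def algebra_simps)
    have "\<bar>(2 * p - 1) * r\<bar> \<le> 1 * r" "\<bar>(1 - 2 * q) * r\<bar> \<le> 1 * r"
      unfolding abs_mult using pq assms(1) by (intro mult_mono; simp)+
    then have "\<forall>m\<in>{1..4}. \<bar>t m\<bar> \<le> r"
      using assms(1) by (simp add: t_def)
    with tx have "x \<in> zono r"
      unfolding mem_zono_iff_sum[OF less_imp_le[OF assms(1)]] by blast
    moreover have "(xi i - xi j) \<bullet> x = 8 * r"
      unfolding tx using \<open>i \<noteq> j\<close>
      by (simp add: inner_diff_xi_sum \<open>i \<in> {1..4}\<close> \<open>j \<in> {1..4}\<close> t_def del: atLeastAtMost_iff)
    ultimately show "x \<in> zono_facet r (i, j)"
      by (simp add: zono_facet_def)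
  qed
  have "norm v = norm w"
    using assms(1) mem by (simp add: v_def w_def norm_xi)
  moreover have "\<not> collinear {0, v, w}"
    unfolding v_def w_def using mem \<open>k \<noteq> l\<close> assms(1) by (intro noncollinear_xi) auto
  moreover have "v + w = (2 * r) *\<^sub>R (xi k - xi l)" "v - w = (2 * r) *\<^sub>R (xi k + xi l)"
    by (simp_all add: v_def w_def algebra_simps)
  then have "norm (v + w) = sqrt 2 * (4 * r)" "norm (v - w) = 4 * r"
    using assms(1) mem \<open>k \<noteq> l\<close> by (simp_all add: norm_xi_diff norm_xi_add)
  ultimately show ?thesis
    unfolding rhombus_def using facet by metis
qed

lemma rhombic_dodecahedron_zono:
  assumes "r > 0"
  shows "rhombic_dodecahedron (zono r)"
  unfolding rhombic_dodecahedron_def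
proof (intro conjI exI[of _ "4 * r"] allI impI)
  fix F assume "F facet_of zono r"
  then show "rhombus F (sqrt 2 * (4 * r)) (4 * r)"
    using rhombus_facet[OF assms] by (auto simp: facet_of_zono_iff[OF assms])
qed (use assms in \<open>simp_all add: polytope_zono aff_dim_zono card_facets_zono\<close>)

subsection \<open>Faces of Minkowski sums and the edges of the zonotope\<close>

text \<open>If \<open>a + b\<close> and \<open>a' + b'\<close> lie in the face, their midpoint is
  also that of \<open>a + b'\<close> and \<open>a' + b\<close>, so the face contains these too.
  Summands can thus be exchanged freely, and the face is the sum of the parts of \<open>A\<close>
  and \<open>B\<close> that occur in it.\<close>

lemma face_of_set_plus:
  fixes A B :: "'a::real_vector set"
  assumes "convex A" "convex B" and F: "F face_of (A + B)" and "F \<noteq> {}"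
  obtains G H where "G face_of A" "H face_of B" "F = G + H"
proof -
  define G where "G = {a \<in> A. \<exists>b\<in>B. a + b \<in> F}"
  define H where "H = {b \<in> B. \<exists>a\<in>A. a + b \<in> F}"
  have sub: "F \<subseteq> A + B" and "convex F"
    and face: "\<And>x y z. \<lbrakk>x \<in> A + B; y \<in> A + B; z \<in> F; z \<in> open_segment x y\<rbrakk> \<Longrightarrow> x \<in> F \<and> y \<in> F"
    using F unfolding face_of_def by blast+
  have exchange: "a + b' \<in> F" if "a \<in> A" "b \<in> B" "a' \<in> A" "b' \<in> B" "a + b \<in> F" "a' + b' \<in> F" for a b a' b'
  proof -
    have mid: "midpoint (a + b) (a' + b') = midpoint (a + b') (a' + b)"
      by (simp add: midpoint_def ac_simps)
    have in_F: "midpoint (a + b) (a' + b') \<in> F"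
      using closed_segment_subset[OF that(5,6) \<open>convex F\<close>] by auto
    show ?thesis
    proof (cases "a + b' = a' + b")
      case True
      then show ?thesis using in_F mid by simp
    next
      case False
      then have "midpoint (a + b) (a' + b') \<in> open_segment (a + b') (a' + b)"
        unfolding mid by simp
      then show ?thesis
        using face[OF set_plus_intro set_plus_intro in_F] that by blast
    qed
  qed
  have GH: "a + b \<in> F" if "a \<in> G" "b \<in> H" for a b
  proof -
    obtain b' where "b' \<in> B" "a + b' \<in> F" "a \<in> A"
      using \<open>a \<in> G\<close> unfolding G_def by blast
    moreover obtain a' where "a' \<in> A" "a' + b \<in> F" "b \<in> B"
      using \<open>b \<in> H\<close> unfolding H_def by blast
    ultimately show ?thesis
      using exchange[of a b' a' b] by simp
  qed
  have "F = G + H"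
  proof
    show "F \<subseteq> G + H"
    proof
      fix x assume "x \<in> F"
      with sub obtain a b where "x = a + b" "a \<in> A" "b \<in> B"
        by (meson set_plus_elim subsetD)
      then show "x \<in> G + H"
        using \<open>x \<in> F\<close> unfolding G_def H_def by blast
    qed
    show "G + H \<subseteq> F"
      using GH by (auto elim!: set_plus_elim)
  qed
  then obtain a0 b0 where a0: "a0 \<in> G" and b0: "b0 \<in> H"
    using \<open>F \<noteq> {}\<close> by (auto simp: set_plus_def)
  then have "a0 \<in> A" "b0 \<in> B"
    by (auto simp: G_def H_def)
  \<comment> \<open>By exchange a single partner \<open>b0\<close> tests membership in
    \<open>G\<close>, so \<open>G\<close> is a translated slice of the face and inherits its
    properties.\<close>
  have G_iff: "a \<in> G \<longleftrightarrow> a \<in> A \<and> b0 + a \<in> F" for a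
    unfolding add.commute[of b0] using GH[OF _ b0] \<open>b0 \<in> B\<close> unfolding G_def by blast
  have H_iff: "b \<in> H \<longleftrightarrow> b \<in> B \<and> a0 + b \<in> F" for b
    using GH[OF a0] \<open>a0 \<in> A\<close> unfolding H_def by blast
  have face_summand: "S face_of C"
    if "convex C" and S: "\<And>x. x \<in> S \<longleftrightarrow> x \<in> C \<and> c + x \<in> F" and C: "\<And>x. x \<in> C \<Longrightarrow> c + x \<in> A + B"
    for S C and c :: 'a
    unfolding face_of_def
  proof (intro conjI ballI impI)
    show "S \<subseteq> C"
      using S by auto
    show "convex S"
    proof (rule convexI)
      fix x y and u v :: real assume *: "x \<in> S" "y \<in> S" "0 \<le> u" "0 \<le> v" "u + v = 1"
      then have "u *\<^sub>R (c + x) + v *\<^sub>R (c + y) \<in> F" "u *\<^sub>R x + v *\<^sub>R y \<in> C"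
        using S convexD[OF \<open>convex F\<close>] convexD[OF \<open>convex C\<close>] by blast+
      moreover have "u *\<^sub>R (c + x) + v *\<^sub>R (c + y) = (u + v) *\<^sub>R c + (u *\<^sub>R x + v *\<^sub>R y)"
        by (simp add: algebra_simps)
      ultimately show "u *\<^sub>R x + v *\<^sub>R y \<in> S"
        using S * by simp
    qed
    show "x \<in> S" "y \<in> S" if "x \<in> C" "y \<in> C" "z \<in> S" "z \<in> open_segment x y" for x y z
    proof -
      have "c + z \<in> open_segment (c + x) (c + y)"
        using that(4) by (simp add: open_segment_translation)
      then have "c + x \<in> F \<and> c + y \<in> F"
        using face[OF C[OF that(1)] C[OF that(2)]] S[of z] that(3) by blast
      then show "x \<in> S" "y \<in> S"
        using S that by simp_all
    qed
  qed
  have "G face_of A"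
    by (rule face_summand[OF \<open>convex A\<close> G_iff]) (subst add.commute, use \<open>b0 \<in> B\<close> in blast)
  moreover have "H face_of B"
    by (rule face_summand[OF \<open>convex B\<close> H_iff]) (use \<open>a0 \<in> A\<close> in blast)
  ultimately show thesis
    using that \<open>F = G + H\<close> by blast
qed

lemma face_of_set_sum:
  fixes A :: "'i \<Rightarrow> 'a::real_vector set"
  assumes "finite I" "\<And>i. i \<in> I \<Longrightarrow> convex (A i)" "F face_of (\<Sum>i\<in>I. A i)" "F \<noteq> {}"
  shows "\<exists>G. (\<forall>i\<in>I. G i face_of A i) \<and> F = (\<Sum>i\<in>I. G i)"
  using assms
proof (induction I arbitrary: F)
  case empty
  then have "F = {0}"
    by (auto simp: face_of_def)
  then show ?case by simp
next
  case (insert k I)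
  have F: "F face_of (A k + (\<Sum>i\<in>I. A i))"
    using insert.prems insert.hyps by simp
  have "convex (A k)" "convex (\<Sum>i\<in>I. A i)"
    using insert.prems(1) by (auto intro: convex_set_sum)
  from face_of_set_plus[OF this F insert.prems(3)]
  obtain G' H where G': "G' face_of A k" and H: "H face_of (\<Sum>i\<in>I. A i)" and eq: "F = G' + H"
    by blast
  have "H \<noteq> {}"
    using eq insert.prems(3) by (auto simp: set_plus_def)
  then obtain G where G: "\<forall>i\<in>I. G i face_of A i" "H = (\<Sum>i\<in>I. G i)"
    using insert.IH[OF _ H] insert.prems(1) by auto
  have "(\<Sum>i\<in>I. (G(k := G')) i) = (\<Sum>i\<in>I. G i)"
    using insert.hyps by (intro sum.cong) auto
  then show ?case
    using G G' eq insert.hyps by (intro exI[of _ "G(k := G')"]) auto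
qed

lemma face_of_closed_segment:
  fixes a b :: "'a::euclidean_space"
  assumes "G face_of closed_segment a b" "G \<noteq> {}" "G \<noteq> closed_segment a b"
  shows "\<exists>c. G = {c}"
proof -
  have "aff_dim G < aff_dim (closed_segment a b)"
    using assms by (intro face_of_aff_dim_lt) auto
  also have "\<dots> \<le> 1"
    using collinear_closed_segment by (simp flip: collinear_aff_dim)
  finally have "aff_dim G \<le> 0" by simp
  moreover have "aff_dim G \<ge> 0"
    using assms(2) aff_dim_geq[of G] aff_dim_empty[of G] by linarith
  ultimately show ?thesis
    by (simp add: aff_dim_eq_0)
qed

lemma sum_singletons: "finite I \<Longrightarrow> (\<Sum>i\<in>I. {c i}) = {\<Sum>i\<in>I. c i}"
  by (induction I rule: finite_induct) (auto simp: set_plus_def)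

text \<open>Each summand of the edge is a point or a full segment. Dimension 1 rules out that all
  are points, and also two full segments, since these have independent directions.\<close>

lemma edge_of_zono:
  assumes "r > 0" and e: "e edge_of zono r"
  shows "\<exists>a b. e = closed_segment a b \<and> dist a b = 2 * sqrt 3 * r"
proof -
  let ?s = "\<lambda>i. closed_segment (- (r *\<^sub>R xi i)) (r *\<^sub>R xi i)"
  have two: "(2 * r) *\<^sub>R z = r *\<^sub>R z + r *\<^sub>R z" for z :: "real^3"
    by (simp flip: scaleR_add_left)
  have "e face_of (\<Sum>i\<in>{1..4}. ?s i)" and dim: "aff_dim e = 1"
    using e by (auto simp: edge_of_def zono_def)
  moreover have "e \<noteq> {}"
    using dim by auto
  ultimately have "\<exists>G. (\<forall>i\<in>{1..4}. G i face_of ?s i) \<and> e = (\<Sum>i\<in>{1..4}. G i)"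
    by (intro face_of_set_sum) auto
  then obtain G where G: "\<forall>i\<in>{1..4}. G i face_of ?s i" and eG: "e = (\<Sum>i\<in>{1..4}. G i)"
    by blast
  have split: "e = G i + (\<Sum>j\<in>{1..4} - {i}. G j)" if "i \<in> {1..4}" for i
    unfolding eG using that by (simp add: sum.remove)
  have "G i \<noteq> {}" if "i \<in> {1..4}" for i
    using split[OF that] \<open>e \<noteq> {}\<close> by (auto simp: set_plus_def)
  then have cases: "G i = ?s i \<or> (\<exists>c. G i = {c})" if "i \<in> {1..4}" for i
    using face_of_closed_segment[OF G[rule_format, OF that]] that by blast
  have "\<exists>k\<in>{1..4}. G k = ?s k"
  proof (rule ccontr)
    assume "\<not> ?thesis"
    then have "\<forall>i\<in>{1..4}. \<exists>c. G i = {c}"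
      using cases by blast
    from bchoice[OF this] obtain c where "\<forall>i\<in>{1..4}. G i = {c i}"
      by blast
    then have "e = (\<Sum>i\<in>{1..4}. {c i})"
      unfolding eG by (intro sum.cong) auto
    with dim show False
      by (simp add: sum_singletons)
  qed
  then obtain k where k: "k \<in> {1..4}" "G k = ?s k" by blast
  have single: "\<exists>c. G l = {c}" if l: "l \<in> {1..4} - {k}" for l
  proof (rule ccontr)
    assume "\<not> ?thesis"
    then have Gl: "G l = ?s l"
      using cases l by blast
    define Q where "Q = (\<Sum>j\<in>{1..4} - {k} - {l}. G j)"
    have "e = G k + (G l + Q)"
      unfolding split[OF k(1)] Q_def using l by (simp add: sum.remove[of "{1..4} - {k}" l])
    then have Q: "e = ?s k + (?s l + Q)"
      by (simp only: k(2) Gl)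
    then obtain q where "q \<in> Q"
      using \<open>e \<noteq> {}\<close> by (auto simp: set_plus_def)
    \<comment> \<open>A corner of a parallelogram inside \<open>e\<close>; with its two neighbours
      it would give three noncollinear points of a line.\<close>
    define y where "y = - (r *\<^sub>R xi k) + (- (r *\<^sub>R xi l) + q)"
    have "y \<in> e"
      unfolding Q y_def using \<open>q \<in> Q\<close> by (intro set_plus_intro) auto
    moreover have "y + (2 * r) *\<^sub>R xi k \<in> e"
    proof -
      have "r *\<^sub>R xi k + (- (r *\<^sub>R xi l) + q) \<in> e"
        unfolding Q using \<open>q \<in> Q\<close> by (intro set_plus_intro) auto
      moreover have "y + (2 * r) *\<^sub>R xi k = r *\<^sub>R xi k + (- (r *\<^sub>R xi l) + q)"
        unfolding y_def two by simp
      ultimately show ?thesis by simp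
    qed
    moreover have "y + (2 * r) *\<^sub>R xi l \<in> e"
    proof -
      have "- (r *\<^sub>R xi k) + (r *\<^sub>R xi l + q) \<in> e"
        unfolding Q using \<open>q \<in> Q\<close> by (intro set_plus_intro) auto
      moreover have "y + (2 * r) *\<^sub>R xi l = - (r *\<^sub>R xi k) + (r *\<^sub>R xi l + q)"
        unfolding y_def two by simp
      ultimately show ?thesis by simp
    qed
    ultimately have "collinear {y + (2 * r) *\<^sub>R xi k, y, y + (2 * r) *\<^sub>R xi l}"
      using dim collinear_subset[of e] by (simp add: collinear_aff_dim[of e])
    then have "collinear {0, (2 * r) *\<^sub>R xi k, (2 * r) *\<^sub>R xi l}"
      by (subst (asm) collinear_3) (simp_all only: add_diff_cancel_left' NO_MATCH_def)
    then show False
      using noncollinear_xi[of k l "2 * r" "2 * r"] k(1) l assms(1) by auto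
  qed
  then have "\<forall>l\<in>{1..4} - {k}. \<exists>c. G l = {c}"
    by blast
  from bchoice[OF this] obtain c where "\<forall>l\<in>{1..4} - {k}. G l = {c l}"
    by blast
  then have "(\<Sum>j\<in>{1..4} - {k}. G j) = (\<Sum>j\<in>{1..4} - {k}. {c j})"
    by (intro sum.cong) auto
  also have "\<dots> = {\<Sum>j\<in>{1..4} - {k}. c j}"
    by (simp add: sum_singletons)
  finally have *: "(\<Sum>j\<in>{1..4} - {k}. G j) = {\<Sum>j\<in>{1..4} - {k}. c j}" .
  define p where "p = (\<Sum>j\<in>{1..4} - {k}. c j)"
  have "e = ?s k + {p}"
    unfolding p_def *[symmetric] k(2)[symmetric] by (rule split[OF k(1)])
  then have "e = (+) p ` ?s k"
    unfolding translation_eq_singleton_plus by (simp only: add.commute)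
  then have "e = closed_segment (p - r *\<^sub>R xi k) (p + r *\<^sub>R xi k)"
    by (simp flip: closed_segment_translation)
  moreover have "dist (p - r *\<^sub>R xi k) (p + r *\<^sub>R xi k) = norm ((2 * r) *\<^sub>R xi k)"
    unfolding dist_norm two by (subst norm_minus_commute) simp
  ultimately show ?thesis
    using assms(1) k(1) by (intro exI[of _ "p - r *\<^sub>R xi k"] exI[of _ "p + r *\<^sub>R xi k"]) (simp add: norm_xi)
qed

text \<open>Keeps \<open>has_edge_length\<close> from being vacuous: a facet of a facet is an
  edge.\<close>

lemma polytope_edge_exists:
  assumes "polytope P" "aff_dim P = 3"
  shows "\<exists>e. e edge_of P"
proof -
  obtain F where F: "F facet_of P"
    using polytope_facet_exists[OF assms(1)] assms(2) by auto
  then have "polytope F" "aff_dim F = 2"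
    using assms by (auto simp: facet_of_def intro: face_of_polytope_polytope)
  then obtain e where "e facet_of F"
    using polytope_facet_exists[of F] by auto
  with F \<open>aff_dim F = 2\<close> show ?thesis
    by (auto simp: edge_of_def facet_of_def intro: face_of_trans)
qed

lemma has_edge_length_zono:
  assumes "r > 0"
  shows "has_edge_length (zono r) (2 * sqrt 3 * r)"
  unfolding has_edge_length_def
  using polytope_edge_exists[OF polytope_zono aff_dim_zono[OF assms]] edge_of_zono[OF assms] by blast

subsection \<open>Width, vertices and the tetrahedron\<close>

text \<open>Support functions add under Minkowski sums, and central symmetry doubles the
  maximum.\<close>

lemma width_zono:
  assumes "r > 0"
  shows "width (zono r) u = 2 * r * (\<Sum>i\<in>{1..4}. \<bar>u \<bullet> xi i\<bar>)"
proof -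
  define M where "M = r * (\<Sum>i\<in>{1..4}. \<bar>u \<bullet> xi i\<bar>)"
  have bound: "\<bar>u \<bullet> x\<bar> \<le> M" if x: "x \<in> zono r" for x
  proof -
    obtain t where t: "\<forall>i\<in>{1..4}. \<bar>t i\<bar> \<le> r" and x: "x = (\<Sum>i\<in>{1..4}. t i *\<^sub>R xi i)"
      using x unfolding mem_zono_iff_sum[OF less_imp_le[OF assms]] by blast
    have "\<bar>u \<bullet> x\<bar> \<le> (\<Sum>i\<in>{1..4}. \<bar>t i * (u \<bullet> xi i)\<bar>)"
      unfolding x inner_sum_right inner_scaleR_right by (rule sum_abs)
    also have "\<dots> \<le> M"
      unfolding M_def sum_distrib_left abs_mult using t by (intro sum_mono mult_right_mono) auto
    finally show ?thesis .
  qed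
  \<comment> \<open>A maximiser: each segment contributes its endpoint on the side of
    \<open>u\<close>, or its midpoint if it is orthogonal to \<open>u\<close>.\<close>
  define v where "v = (\<Sum>i\<in>{1..4}. (r * sgn (u \<bullet> xi i)) *\<^sub>R xi i)"
  have sgn_le: "\<bar>r * sgn y\<bar> \<le> r" for y :: real
    using assms by (simp add: abs_mult sgn_real_def)
  have "v \<in> zono r"
    unfolding mem_zono_iff_sum[OF less_imp_le[OF assms]] v_def using sgn_le
    by (intro exI[of _ "\<lambda>i. r * sgn (u \<bullet> xi i)"]) simp
  have "- v \<in> zono r"
    unfolding mem_zono_iff_sum[OF less_imp_le[OF assms]] v_def using sgn_le
    by (intro exI[of _ "\<lambda>i. - (r * sgn (u \<bullet> xi i))"]) (simp add: sum_negf)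
  have uv: "u \<bullet> v = M"
    unfolding v_def M_def inner_sum_right sum_distrib_left
    by (intro sum.cong) (simp_all add: abs_sgn mult.assoc mult.commute)
  have "(SUP x\<in>zono r. u \<bullet> x) = M"
    using bound \<open>v \<in> zono r\<close> uv by (intro cSup_eq_maximum) (auto simp: abs_le_iff)
  moreover have "(INF x\<in>zono r. u \<bullet> x) = - M"
  proof (rule cInf_eq_minimum)
    show "- M \<in> (\<lambda>x. u \<bullet> x) ` zono r"
      using \<open>- v \<in> zono r\<close> uv by (intro image_eqI[of _ _ "- v"]) auto
    show "- M \<le> y" if "y \<in> (\<lambda>x. u \<bullet> x) ` zono r" for y
      using that bound by (force simp: abs_le_iff)
  qed
  ultimately show ?thesis
    by (simp add: width_def M_def)
qed

lemma Z_T_eq_zono: "Z_T = zono (1/16)"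
  by (simp add: Z_T_def zono_def)

text \<open>The half-space description is homogeneous in \<open>x\<close> and \<open>r\<close>. The
  value \<open>sqrt 3 / 6\<close> solves \<open>2 * sqrt 3 * r = 1\<close>.\<close>

lemma R_body_eq_zono: "R_body = zono (sqrt 3 / 6)"
proof -
  define c where "c = 8 / sqrt 3"
  have c: "c > 0" "c * (1/16) = sqrt 3 / 6"
    by (simp_all add: c_def field_simps)
  have "x \<in> (*\<^sub>R) c ` zono (1/16) \<longleftrightarrow> x \<in> zono (c * (1/16))" for x
  proof -
    have "x \<in> (*\<^sub>R) c ` zono (1/16) \<longleftrightarrow> inverse c *\<^sub>R x \<in> zono (1/16)"
      using c(1) by (auto simp: image_iff intro!: bexI[of _ "inverse c *\<^sub>R x"])
    also have "\<dots> \<longleftrightarrow> x \<in> zono (c * (1/16))"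
      using c(1) by (simp add: mem_zono_iff_halfspaces field_simps)
    finally show ?thesis .
  qed
  then show ?thesis
    unfolding R_body_def Z_T_eq_zono c_def[symmetric] c(2)[symmetric] by blast
qed

section \<open>Vertices of \<open>Z_T\<close> in coordinates\<close>

lemma abs_add_abs_le_iff:
  fixes a b c :: real
  shows "\<bar>a\<bar> + \<bar>b\<bar> \<le> c \<longleftrightarrow> a + b \<le> c \<and> a - b \<le> c \<and> - a + b \<le> c \<and> - a - b \<le> c"
  by linarith

text \<open>The normals \<open>xi i - xi j\<close> are the vectors with two entries 2 or -2 and one
  entry 0, so the bound 8/16 becomes 1/4.\<close>

lemma mem_Z_T_iff:
  "x \<in> Z_T \<longleftrightarrow> \<bar>x$1\<bar> + \<bar>x$2\<bar> \<le> 1/4 \<and> \<bar>x$1\<bar> + \<bar>x$3\<bar> \<le> 1/4 \<and> \<bar>x$2\<bar> + \<bar>x$3\<bar> \<le> 1/4"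
proof -
  have "x \<in> Z_T \<longleftrightarrow> (\<forall>i\<in>{1, 2, 3, 4}. \<forall>j\<in>{1, 2, 3, 4}. (xi i - xi j) \<bullet> x \<le> 1/2)"
    unfolding Z_T_eq_zono atLeastAtMost_1_4[symmetric] by (subst mem_zono_iff_halfspaces) simp_all
  also have "\<dots> \<longleftrightarrow> \<bar>x$1\<bar> + \<bar>x$2\<bar> \<le> 1/4 \<and> \<bar>x$1\<bar> + \<bar>x$3\<bar> \<le> 1/4 \<and> \<bar>x$2\<bar> + \<bar>x$3\<bar> \<le> 1/4"
    unfolding abs_add_abs_le_iff by (simp add: xi_simps inner_3) (intro iffI; elim conjE; intro conjI; linarith)
  finally show ?thesis .
qed

lemma mem_Z_T_vertices_iff:
  "x \<in> Z_T_vertices \<longleftrightarrow> \<bar>x$1\<bar> = 1/4 \<and> x$2 = 0 \<and> x$3 = 0 \<or> x$1 = 0 \<and> \<bar>x$2\<bar> = 1/4 \<and> x$3 = 0 \<or>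
    x$1 = 0 \<and> x$2 = 0 \<and> \<bar>x$3\<bar> = 1/4 \<or> \<bar>x$1\<bar> = 1/8 \<and> \<bar>x$2\<bar> = 1/8 \<and> \<bar>x$3\<bar> = 1/8"
proof -
  have sgn: "(\<exists>s. a = s / c \<and> s \<in> {-1, 1}) \<longleftrightarrow> \<bar>a\<bar> = 1 / c" if "c > 0" for a c :: real
  proof -
    have "(\<exists>s. a = s / c \<and> s \<in> {-1, 1}) \<longleftrightarrow> a = (-1) / c \<or> a = 1 / c"
      by blast
    then show ?thesis
      using that by (simp add: abs_eq_iff' disj_commute)
  qed
  have "x \<in> Z_T_vertices \<longleftrightarrow>
      (\<exists>s. x$1 = s/4 \<and> s \<in> {-1, 1}) \<and> x$2 = 0 \<and> x$3 = 0 \<or>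
      x$1 = 0 \<and> (\<exists>s. x$2 = s/4 \<and> s \<in> {-1, 1}) \<and> x$3 = 0 \<or>
      x$1 = 0 \<and> x$2 = 0 \<and> (\<exists>s. x$3 = s/4 \<and> s \<in> {-1, 1}) \<or>
      (\<exists>s. x$1 = s/8 \<and> s \<in> {-1, 1}) \<and> (\<exists>s. x$2 = s/8 \<and> s \<in> {-1, 1}) \<and> (\<exists>s. x$3 = s/8 \<and> s \<in> {-1, 1})"
    unfolding Z_T_vertices_def Un_iff mem_Collect_eq vec_eq_iff forall_3 vector_3 by blast
  then show ?thesis
    by (simp only: sgn zero_less_numeral)
qed

lemma extreme_point_of_strict_max:
  fixes S :: "'a::real_inner set"
  assumes "convex S" "v \<in> S" "\<And>y. y \<in> S \<Longrightarrow> u \<bullet> y \<le> u \<bullet> v" "\<And>y. y \<in> S \<Longrightarrow> u \<bullet> y = u \<bullet> v \<Longrightarrow> y = v"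
  shows "v extreme_point_of S"
proof -
  have "(S \<inter> {y. u \<bullet> y = u \<bullet> v}) face_of S"
    using assms by (intro face_of_Int_supporting_hyperplane_le) auto
  moreover have "S \<inter> {y. u \<bullet> y = u \<bullet> v} = {v}"
    using assms by auto
  ultimately show ?thesis
    by (simp add: face_of_singleton)
qed

lemma linear_max_axis:
  fixes p a b c :: real
  assumes p: "\<bar>p\<bar> = 1/4" and le: "\<bar>a\<bar> + \<bar>b\<bar> \<le> 1/4" "\<bar>a\<bar> + \<bar>c\<bar> \<le> 1/4"
  shows "p * a \<le> p * p \<and> (p * a = p * p \<longrightarrow> a = p \<and> b = 0 \<and> c = 0)"
proof -
  have "\<bar>a\<bar> \<le> \<bar>p\<bar>"
    using le p by linarith
  moreover have "b = 0" "c = 0" if "\<bar>a\<bar> = \<bar>p\<bar>"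
    using that le p by linarith+
  moreover have "p * a \<le> \<bar>p\<bar> * \<bar>a\<bar>" "p * p = \<bar>p\<bar> * \<bar>p\<bar>"
    by (simp_all flip: abs_mult)
  moreover have "p \<noteq> 0"
    using p by auto
  ultimately show ?thesis
    using mult_left_mono[of "\<bar>a\<bar>" "\<bar>p\<bar>" "\<bar>p\<bar>"] by auto
qed

text \<open>Adding the three constraints gives |a| + |b| + |c| at most 3/8. Equality of the
  functionals makes each absolute value 1/8, and the products then fix the signs.\<close>

lemma linear_max_corner:
  fixes p q r a b c :: real
  assumes pqr: "\<bar>p\<bar> = 1/8" "\<bar>q\<bar> = 1/8" "\<bar>r\<bar> = 1/8"
    and le: "\<bar>a\<bar> + \<bar>b\<bar> \<le> 1/4" "\<bar>a\<bar> + \<bar>c\<bar> \<le> 1/4" "\<bar>b\<bar> + \<bar>c\<bar> \<le> 1/4"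
  shows "p * a + q * b + r * c \<le> p * p + q * q + r * r \<and>
    (p * a + q * b + r * c = p * p + q * q + r * r \<longrightarrow> a = p \<and> b = q \<and> c = r)"
proof -
  have prod: "s * x \<le> 1/8 * \<bar>x\<bar>" "s * s = 1/64" if s: "\<bar>s\<bar> = 1/8" for s x :: real
  proof -
    show "s * x \<le> 1/8 * \<bar>x\<bar>"
      using abs_ge_self[of "s * x"] unfolding abs_mult s .
    have "s * s = \<bar>s\<bar> * \<bar>s\<bar>"
      by simp
    then show "s * s = 1/64"
      unfolding s by simp
  qed
  define A B C where ABC: "A = \<bar>a\<bar>" "B = \<bar>b\<bar>" "C = \<bar>c\<bar>"
  have bounds: "p * a \<le> 1/8 * A" "q * b \<le> 1/8 * B" "r * c \<le> 1/8 * C"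
    "p * p = 1/64" "q * q = 1/64" "r * r = 1/64"
    using prod[OF pqr(1)] prod[OF pqr(2)] prod[OF pqr(3)] by (simp_all only: ABC)
  note le = le[folded ABC]
  have "p * a + q * b + r * c \<le> p * p + q * q + r * r"
    using bounds le by linarith
  moreover have "a = p \<and> b = q \<and> c = r" if eq: "p * a + q * b + r * c = p * p + q * q + r * r"
  proof -
    have "p * a = p * p" "q * b = q * q" "r * c = r * r"
      using eq bounds le by linarith+
    then show ?thesis
      using pqr by auto
  qed
  ultimately show ?thesis by blast
qed

lemma extreme_points_Z_T: "{v. v extreme_point_of Z_T} = Z_T_vertices"
proof (intro equalityI subsetI)
  fix v assume "v \<in> {v. v extreme_point_of Z_T}"
  then have v: "v extreme_point_of Z_T" by simp
  then have "v \<in> (\<Sum>i\<in>{1..4}. {- ((1/16) *\<^sub>R xi i), (1/16) *\<^sub>R xi i})"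
    unfolding Z_T_eq_zono zono_hull by (rule extreme_point_of_convex_hull)
  then obtain s where s: "\<forall>i\<in>{1..4}. s i = - ((1/16) *\<^sub>R xi i) \<or> s i = (1/16) *\<^sub>R xi i" and vs: "v = sum s {1..4}"
    by (subst (asm) set_sum_alt) auto
  have "\<exists>e. e \<in> {-1, 1} \<and> s i = (e / 16) *\<^sub>R xi i" if "i \<in> {1..4}" for i
    using s[rule_format, OF that] by (elim disjE) (rule exI[of _ "-1"] exI[of _ 1]; simp)+
  then have "\<forall>i\<in>{1..4}. \<exists>e. e \<in> {-1, 1} \<and> s i = (e / 16) *\<^sub>R xi i"
    by blast
  from bchoice[OF this] obtain e
    where e: "\<forall>i\<in>{1..4}. e i \<in> {-1, 1} \<and> s i = (e i / 16) *\<^sub>R xi i" by blast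
  then have "v = (\<Sum>i\<in>{1..4}. (e i / 16) *\<^sub>R xi i)"
    unfolding vs by (intro sum.cong) auto
  then have coords: "v$1 = (e 1 + e 2 - e 3 - e 4) / 16" "v$2 = (e 1 - e 2 + e 3 - e 4) / 16"
    "v$3 = (e 1 - e 2 - e 3 + e 4) / 16"
    unfolding sum_1_4 xi_simps by (simp_all add: add_divide_distrib diff_divide_distrib)
  have "e 1 = -1 \<or> e 1 = 1" "e 2 = -1 \<or> e 2 = 1" "e 3 = -1 \<or> e 3 = 1" "e 4 = -1 \<or> e 4 = 1"
    using e unfolding atLeastAtMost_1_4 by blast+
  \<comment> \<open>Of the sixteen sign patterns, six with two minus signs give axis points, eight
    with one or three give corners, and the two constant ones give 0.\<close>
  then have "v = 0 \<or> v \<in> Z_T_vertices"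
    unfolding mem_Z_T_vertices_iff vec_eq_iff forall_3 zero_index coords
    by (elim disjE; simp)
  moreover have "v \<noteq> 0"
  proof
    assume "v = 0"
    define w :: "real^3" where "w = vector [1/4, 0, 0]"
    have "w \<in> Z_T" "- w \<in> Z_T"
      by (simp_all add: mem_Z_T_iff w_def)
    moreover have "w \<noteq> - w"
      by (simp add: w_def vec_eq_iff forall_3)
    then have "midpoint w (- w) \<in> open_segment w (- w)"
      by simp
    then have "0 \<in> open_segment w (- w)"
      by (simp add: midpoint_def)
    ultimately show False
      using v \<open>v = 0\<close> by (auto simp: extreme_point_of_def)
  qed
  ultimately show "v \<in> Z_T_vertices" by blast
next
  fix v assume v: "v \<in> Z_T_vertices"
  \<comment> \<open>Each candidate is exposed by itself as linear functional.\<close>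
  have max: "v \<bullet> y \<le> v \<bullet> v \<and> (v \<bullet> y = v \<bullet> v \<longrightarrow> y = v)" if y: "y \<in> Z_T" for y
  proof -
    have le: "\<bar>y$1\<bar> + \<bar>y$2\<bar> \<le> 1/4" "\<bar>y$1\<bar> + \<bar>y$3\<bar> \<le> 1/4" "\<bar>y$2\<bar> + \<bar>y$3\<bar> \<le> 1/4"
      "\<bar>y$2\<bar> + \<bar>y$1\<bar> \<le> 1/4" "\<bar>y$3\<bar> + \<bar>y$1\<bar> \<le> 1/4" "\<bar>y$3\<bar> + \<bar>y$2\<bar> \<le> 1/4"
      using y unfolding mem_Z_T_iff by (simp_all only: add.commute)
    consider "\<bar>v$1\<bar> = 1/4" "v$2 = 0" "v$3 = 0" | "\<bar>v$2\<bar> = 1/4" "v$1 = 0" "v$3 = 0"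
      | "\<bar>v$3\<bar> = 1/4" "v$1 = 0" "v$2 = 0" | "\<bar>v$1\<bar> = 1/8" "\<bar>v$2\<bar> = 1/8" "\<bar>v$3\<bar> = 1/8"
      using v unfolding mem_Z_T_vertices_iff by blast
    then show ?thesis
    proof cases
      case 1
      then show ?thesis
        unfolding inner_3 vec_eq_iff[of y v] forall_3
        using linear_max_axis[OF 1(1) le(1,2)] by simp
    next
      case 2
      then show ?thesis
        unfolding inner_3 vec_eq_iff[of y v] forall_3
        using linear_max_axis[OF 2(1) le(4,3)] by simp
    next
      case 3
      then show ?thesis
        unfolding inner_3 vec_eq_iff[of y v] forall_3
        using linear_max_axis[OF 3(1) le(5,6)] by simp
    next
      case 4
      show ?thesis
        unfolding inner_3 vec_eq_iff[of y v] forall_3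
        by (rule linear_max_corner[OF 4 le(1-3)])
    qed
  qed
  have "v extreme_point_of Z_T"
  proof (rule extreme_point_of_strict_max)
    show "convex Z_T"
      unfolding Z_T_eq_zono zono_hull by (rule convex_convex_hull)
    show "v \<in> Z_T"
      using v unfolding mem_Z_T_vertices_iff mem_Z_T_iff by auto
  qed (use max in blast)+
  then show "v \<in> {v. v extreme_point_of Z_T}" by simp
qed

lemma card_Z_T_vertices: "card Z_T_vertices = 14"
proof -
  define f :: "real \<times> real \<times> real \<Rightarrow> real^3" where "f = (\<lambda>(a, b, c). vector [a, b, c])"
  define S :: "(real \<times> real \<times> real) set" where
    "S = {-(1/4), 1/4} \<times> {0} \<times> {0} \<union> {0} \<times> {-(1/4), 1/4} \<times> {0} \<union> {0} \<times> {0} \<times> {-(1/4), 1/4}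
      \<union> {-(1/8), 1/8} \<times> {-(1/8), 1/8} \<times> {-(1/8), 1/8}"
  have "inj f"
    by (rule injI) (auto simp: f_def vec_eq_iff forall_3)
  have mem: "x \<in> Z_T_vertices \<longleftrightarrow> (x$1, x$2, x$3) \<in> S" for x
  proof -
    have sgn: "\<bar>a\<bar> = c \<longleftrightarrow> a \<in> {-c, c}" if "c > 0" for a c :: real
      using that by (auto simp: abs_eq_iff')
    show ?thesis
      unfolding mem_Z_T_vertices_iff S_def by (simp only: sgn zero_less_divide_1_iff zero_less_numeral
          Un_iff mem_Sigma_iff singleton_iff) (simp only: disj_assoc)
  qed
  have "Z_T_vertices = f ` S"
  proof (intro equalityI subsetI)
    fix x assume "x \<in> Z_T_vertices"
    moreover have "x = f (x$1, x$2, x$3)"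
      by (simp add: f_def vec_eq_iff forall_3)
    ultimately show "x \<in> f ` S"
      using mem by blast
  qed (auto simp: mem f_def)
  then have "card Z_T_vertices = card S"
    using card_image[OF inj_on_subset[OF \<open>inj f\<close> subset_UNIV], of S] by simp
  also have "\<dots> = 14"
    unfolding S_def by (subst card_Un_disjoint; simp add: card_cartesian_product)+
  finally show ?thesis .
qed

section \<open>The regular tetrahedron\<close>

lemma regular_tetrahedron_T_body: "regular_tetrahedron T_body 1"
proof -
  define p where "p i = (1 / sqrt 8) *\<^sub>R xi i" for i
  let ?C = "p ` {1..4}"
  have T: "T_body = convex hull ?C"
    by (simp add: T_body_def p_def)
  have dist: "dist (p i) (p j) = 1" if "i \<in> {1..4}" "j \<in> {1..4}" "i \<noteq> j" for i j
  proof -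
    have "dist (p i) (p j) = norm (xi i - xi j) / sqrt 8"
      by (simp add: dist_norm p_def flip: scaleR_diff_right)
    also have "sqrt 8 = 2 * sqrt 2"
      using real_sqrt_mult[of 4 2] by simp
    finally show ?thesis
      using that by (simp add: norm_xi_diff)
  qed
  then have inj: "inj_on p {1..4}"
    by (intro inj_onI) fastforce
  have indep: "\<not> affine_dependent ?C"
  proof
    assume "affine_dependent ?C"
    then obtain U where U: "sum U ?C = 0" "\<exists>v\<in>?C. U v \<noteq> 0" "(\<Sum>v\<in>?C. U v *\<^sub>R v) = 0"
      using affine_dependent_explicit_finite[of ?C] by auto
    define t where "t i = U (p i)" for i
    have t0: "(\<Sum>i\<in>{1..4}. t i) = 0"
      using U(1) by (simp add: sum.reindex[OF inj] t_def)
    have "(1 / sqrt 8) *\<^sub>R (\<Sum>i\<in>{1..4}. t i *\<^sub>R xi i) = 0"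
      using U(3) unfolding sum.reindex[OF inj] scaleR_sum_right
      by (simp add: t_def p_def)
    then have "(\<Sum>i\<in>{1..4}. t i *\<^sub>R xi i) = 0"
      by simp
    \<comment> \<open>Constant coefficients are the only linear relation among the
      \<open>xi i\<close>; the zero sum demanded of an affine one leaves only the trivial
      relation.\<close>
    then have eq: "t i = t j" if "i \<in> {1..4}" "j \<in> {1..4}" for i j
      using inner_diff_xi_sum[OF that, of t] by simp
    have "t i = 0" if "i \<in> {1..4}" for i
    proof -
      have "t 1 = t i" "t 2 = t i" "t 3 = t i" "t 4 = t i"
        by (rule eq[OF _ that]; simp)+
      with t0 show ?thesis unfolding sum_1_4 by linarith
    qed
    then show False
      using U(2) by (auto simp: t_def)
  qed
  have "3 simplex T_body"
    unfolding T by (rule simplex_convex_hull) (simp add: indep card_image[OF inj])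
  moreover have "has_edge_length T_body 1"
    unfolding has_edge_length_def
  proof (intro conjI allI impI)
    show "\<exists>e. e edge_of T_body"
      using \<open>3 simplex T_body\<close> by (intro polytope_edge_exists simplex_imp_polytope aff_dim_simplex)
  next
    fix e assume "e edge_of T_body"
    then have "e face_of convex hull ?C" and dim: "aff_dim e = 1"
      by (auto simp: edge_of_def T)
    then obtain c where c: "c \<subseteq> ?C" "e = convex hull c"
      unfolding face_of_convex_hull_affine_independent[OF indep] by blast
    have "\<not> affine_dependent c"
      using indep c(1) affine_independent_subset by blast
    \<comment> \<open>Faces of a simplex are hulls of vertex subsets, so an edge joins two vertices,
      and all pairs have the same distance.\<close>
    then have "card c = 2"
      using aff_dim_affine_independent[of c] dim c(2) by (simp add: aff_dim_convex_hull)
    then obtain a b where "c = {a, b}" "a \<noteq> b"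
      by (auto simp: card_2_iff)
    moreover from this obtain i j where "a = p i" "b = p j" "i \<in> {1..4}" "j \<in> {1..4}"
      using c(1) by auto
    ultimately show "\<exists>a b. e = closed_segment a b \<and> dist a b = 1"
      using c(2) dist[of i j] by (intro exI[of _ a] exI[of _ b]) (auto simp: segment_convex_hull)
  qed
  ultimately show ?thesis
    by (simp add: regular_tetrahedron_def)
qed

theorem proposition5p8:
  shows "{v. v extreme_point_of Z_T} = Z_T_vertices \<and>
         card Z_T_vertices = 14 \<and>
         has_edge_length Z_T (sqrt 3 / 8) \<and>
         rhombic_dodecahedron R_body \<and>
         has_edge_length R_body 1 \<and>
         regular_tetrahedron T_body 1 \<and>
         (\<forall>u \<in> sphere 0 1. width R_body u = (8 / sqrt 3) * brightness T_body u)"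
proof (intro conjI ballI)
  show "has_edge_length Z_T (sqrt 3 / 8)"
    using has_edge_length_zono[of "1/16"] by (simp add: Z_T_eq_zono)
  show "rhombic_dodecahedron R_body"
    unfolding R_body_eq_zono by (rule rhombic_dodecahedron_zono) simp
  show "has_edge_length R_body 1"
    using has_edge_length_zono[of "sqrt 3 / 6"] by (simp add: R_body_eq_zono)
  show "width R_body u = (8 / sqrt 3) * brightness T_body u" if "u \<in> sphere 0 1" for u
  proof -
    have "width R_body u = 2 * (sqrt 3 / 6) * (\<Sum>i\<in>{1..4}. \<bar>u \<bullet> xi i\<bar>)"
      unfolding R_body_eq_zono by (rule width_zono) simp
    \<comment> \<open>Split so that the 1/8 is absorbed by the brightness.\<close>
    also have "2 * (sqrt 3 / 6) = 8 / sqrt 3 / 8"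
      by (simp add: field_simps)
    also have "8 / sqrt 3 / 8 * (\<Sum>i\<in>{1..4}. \<bar>u \<bullet> xi i\<bar>) = 8 / sqrt 3 * brightness T_body u"
      using that by (simp add: brightness_T_body)
    finally show ?thesis .
  qed
qed (fact extreme_points_Z_T card_Z_T_vertices regular_tetrahedron_T_body)+

end
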